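(* Let $(X,r)$ be a finite (nonempty) non-degenerate involutive set-theoretic solution of the Yang-Baxter equation whose permutation group $\mathcal{G}(X,r)$ has cardinality a cube-free number. Then $(X,r)$ is a multipermutation solution.
   Context: A set-theoretic solution of the Yang-Baxter equation is a pair $(X,r)$, with $X$ a set and $r:X\times X\to X\times X$, $r(x,y)=(\sigma_x(y),\tau_y(x))$, a bijection such that $(r\times \mathrm{id}_X)(\mathrm{id}_X\times r)(r\times \mathrm{id}_X)=(\mathrm{id}_X\times r)(r\times \mathrm{id}_X)(\mathrm{id}_X\times r)$. It is non-degenerate if all maps $\sigma_x,\tau_x:X\to X$ are bijective, and involutive if $r^2=\mathrm{id}_{X\times X}$. The permutation group $\mathcal{G}(X,r)$ is the subgroup of $\mathrm{Sym}(X)$ generated by $\{\sigma_x: x\in X\}$. For a non-degenerate involutive solution, define $x\sim y$ iff $\sigma_x=\sigma_y$; then $r$ induces a non-degenerate involutive solution on $X/\!\sim$, namely $([x],[y])\mapsto([\sigma_x(y)],[\tau_y(x)])$, called the retraction of $(X,r)$. The solution $(X,r)$ is a multipermutation solution (has a finite multipermutation level) if there is a nonnegative integer $m$ such that after applying the retraction operation $m$ times one obtains a solution of cardinality $1$. A positive integer is cube-free if it is not divisible by the cube of any prime. *)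

theory Defs
  imports "HOL-Algebra.Elementary_Groups" "HOL-Algebra.Bij" "HOL-Computational_Algebra.Primes"
begin

text \<open>
  A solution lives on a carrier set \<open>X\<close>; values of \<open>r\<close> outside \<open>X \<times> X\<close> are irrelevant.
  The maps \<open>\<sigma>\<^sub>x\<close> and \<open>\<tau>\<^sub>y\<close> are restricted to \<open>X\<close>, so that HOL equality between them is
  equality of maps on \<open>X\<close>.
\<close>

definition sigma_map :: "'a set \<Rightarrow> ('a \<times> 'a \<Rightarrow> 'a \<times> 'a) \<Rightarrow> 'a \<Rightarrow> 'a \<Rightarrow> 'a" where
  "sigma_map X r x = (\<lambda>y\<in>X. fst (r (x, y)))"

definition tau_map :: "'a set \<Rightarrow> ('a \<times> 'a \<Rightarrow> 'a \<times> 'a) \<Rightarrow> 'a \<Rightarrow> 'a \<Rightarrow> 'a" where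
  "tau_map X r y = (\<lambda>x\<in>X. snd (r (x, y)))"

definition act12 :: "('a \<times> 'a \<Rightarrow> 'a \<times> 'a) \<Rightarrow> 'a \<times> 'a \<times> 'a \<Rightarrow> 'a \<times> 'a \<times> 'a" where
  "act12 r = (\<lambda>(x, y, z). (fst (r (x, y)), snd (r (x, y)), z))"

definition act23 :: "('a \<times> 'a \<Rightarrow> 'a \<times> 'a) \<Rightarrow> 'a \<times> 'a \<times> 'a \<Rightarrow> 'a \<times> 'a \<times> 'a" where
  "act23 r = map_prod id r"

definition ybe_solution :: "'a set \<Rightarrow> ('a \<times> 'a \<Rightarrow> 'a \<times> 'a) \<Rightarrow> bool" where
  "ybe_solution X r \<longleftrightarrow>
     bij_betw r (X \<times> X) (X \<times> X) \<and>
     (\<forall>t \<in> X \<times> X \<times> X. (act12 r \<circ> act23 r \<circ> act12 r) t = (act23 r \<circ> act12 r \<circ> act23 r) t)"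

definition nondegenerate :: "'a set \<Rightarrow> ('a \<times> 'a \<Rightarrow> 'a \<times> 'a) \<Rightarrow> bool" where
  "nondegenerate X r \<longleftrightarrow>
     (\<forall>x\<in>X. bij_betw (sigma_map X r x) X X) \<and> (\<forall>y\<in>X. bij_betw (tau_map X r y) X X)"

definition involutive :: "'a set \<Rightarrow> ('a \<times> 'a \<Rightarrow> 'a \<times> 'a) \<Rightarrow> bool" where
  "involutive X r \<longleftrightarrow> (\<forall>p \<in> X \<times> X. r (r p) = p)"

definition permutation_group :: "'a set \<Rightarrow> ('a \<times> 'a \<Rightarrow> 'a \<times> 'a) \<Rightarrow> ('a \<Rightarrow> 'a) monoid" where
  "permutation_group X r = subgroup_generated (BijGroup X) (sigma_map X r ` X)"

definition retract_rel :: "'a set \<Rightarrow> ('a \<times> 'a \<Rightarrow> 'a \<times> 'a) \<Rightarrow> ('a \<times> 'a) set" where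
  "retract_rel X r = {(x, y). x \<in> X \<and> y \<in> X \<and> sigma_map X r x = sigma_map X r y}"

definition retraction_set :: "'a set \<Rightarrow> ('a \<times> 'a \<Rightarrow> 'a \<times> 'a) \<Rightarrow> 'a set set" where
  "retraction_set X r = X // retract_rel X r"

text \<open>
  The induced map \<open>([x], [y]) \<mapsto> ([\<sigma>\<^sub>x y], [\<tau>\<^sub>y x])\<close>. As usual for operations on quotients, the
  value is written as a union over representatives; for a non-degenerate involutive solution
  every member of the union is the same class.
\<close>

definition retraction_map ::
  "'a set \<Rightarrow> ('a \<times> 'a \<Rightarrow> 'a \<times> 'a) \<Rightarrow> 'a set \<times> 'a set \<Rightarrow> 'a set \<times> 'a set" where
  "retraction_map X r = (\<lambda>(A, B).
     (\<Union>x\<in>A. \<Union>y\<in>B. retract_rel X r `` {sigma_map X r x y},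
      \<Union>x\<in>A. \<Union>y\<in>B. retract_rel X r `` {tau_map X r y x}))"

definition isomorphic_solutions ::
  "'a set \<Rightarrow> ('a \<times> 'a \<Rightarrow> 'a \<times> 'a) \<Rightarrow> 'b set \<Rightarrow> ('b \<times> 'b \<Rightarrow> 'b \<times> 'b) \<Rightarrow> bool" where
  "isomorphic_solutions X r Y s \<longleftrightarrow>
     (\<exists>f. bij_betw f X Y \<and> (\<forall>p \<in> X \<times> X. s (map_prod f f p) = map_prod f f (r p)))"

text \<open>
  \<open>iterated_retraction X r m Y s\<close>: applying the retraction \<open>m\<close> times to \<open>(X, r)\<close> gives \<open>(Y, s)\<close>,
  up to isomorphism. The retraction of a solution over \<open>'a\<close> is a solution over \<open>'a set\<close>; to iterate,
  each retraction is replaced by an isomorphic copy over \<open>'a\<close>. A copy always exists,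
  see \<open>retraction_copy_exists\<close>.
\<close>

inductive iterated_retraction ::
  "'a set \<Rightarrow> ('a \<times> 'a \<Rightarrow> 'a \<times> 'a) \<Rightarrow> nat \<Rightarrow> 'a set \<Rightarrow> ('a \<times> 'a \<Rightarrow> 'a \<times> 'a) \<Rightarrow> bool"
  for X r where
  zero: "iterated_retraction X r 0 X r"
| Suc: "iterated_retraction X r m Y s \<Longrightarrow>
        isomorphic_solutions (retraction_set Y s) (retraction_map Y s) Z t \<Longrightarrow>
        iterated_retraction X r (Suc m) Z t"

definition multipermutation :: "'a set \<Rightarrow> ('a \<times> 'a \<Rightarrow> 'a \<times> 'a) \<Rightarrow> bool" where
  "multipermutation X r \<longleftrightarrow> (\<exists>m Y s. iterated_retraction X r m Y s \<and> card Y = 1)"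

definition cube_free :: "nat \<Rightarrow> bool" where
  "cube_free n \<longleftrightarrow> n > 0 \<and> (\<forall>p. Factorial_Ring.prime p \<longrightarrow> \<not> p ^ 3 dvd n)"

lemma equiv_retract_rel: "equiv X (retract_rel X r)"
  by (rule equivI) (auto simp: retract_rel_def refl_on_def sym_def trans_def)

lemma retraction_copy_exists:
  fixes X :: "'a set"
  shows "\<exists>(Z :: 'a set) t. isomorphic_solutions (retraction_set X r) (retraction_map X r) Z t"
proof -
  define Q where "Q = retraction_set X r"
  define f :: "'a set \<Rightarrow> 'a" where "f = (\<lambda>A. SOME x. x \<in> A)"
  have f: "f A \<in> A" if "A \<in> Q" for A
    using in_quotient_imp_non_empty[OF equiv_retract_rel, of A X r] that
    unfolding Q_def retraction_set_def f_def by (auto intro: someI)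
  have inj: "inj_on f Q"
  proof (rule inj_onI)
    fix A B assume AB: "A \<in> Q" "B \<in> Q" "f A = f B"
    then have "f A \<in> A \<inter> B" using f[of A] f[of B] by simp
    then show "A = B"
      using quotient_disj[OF equiv_retract_rel, of A X r B] AB
      unfolding Q_def retraction_set_def by blast
  qed
  define g where "g = the_inv_into Q f"
  define t where "t = map_prod f f \<circ> retraction_map X r \<circ> map_prod g g"
  have "t (map_prod f f p) = map_prod f f (retraction_map X r p)" if "p \<in> Q \<times> Q" for p
    using that inj by (auto simp: t_def g_def the_inv_into_f_f)
  then show ?thesis
    using inj unfolding isomorphic_solutions_def Q_def[symmetric] bij_betw_def by blast
qed

end

theory Submission
  imports Defs "HOL-Algebra.Sylow" "HOL-Algebra.Group_Action" "HOL-Algebra.Multiplicative_Group"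
begin

text \<open>
  The group \<open>G = \<G>(X, r)\<close> carries a left brace structure: for \<open>x \<in> X\<close> the maps
  \<open>g \<mapsto> g \<sigma>\<^sub>y\<close>, \<open>y = g\<^sup>-\<^sup>1(x)\<close>, commute and generate a regular abelian permutation group normalised by the left multiplications, so that
  \<open>G\<close> gets a second, abelian group structure. If \<open>\<sigma>\<close> is injective on \<open>X\<close>, then the socle of this
  brace (the kernel of the action \<open>\<lambda>\<close> of \<open>G\<close> on its additive group) is trivial. Hence, if non-trivial
  braces of cube-free order have non-trivial socle, then the retraction strictly decreases \<open>|X|\<close>
  unless \<open>|X| = 1\<close>; as the permutation group of the retraction is a quotient of \<open>G\<close>, induction applies.

  For the socle, let \<open>A\<^sub>q\<close> be the additive \<open>q\<close>-primary parts, which have order at most \<open>q\<^sup>2\<close>. They are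
  \<open>\<lambda>\<close>-invariant subgroups for both operations, and by counting fixed points of \<open>q\<close>-groups some
  \<open>1 \<noteq> l \<in> A\<^sub>q\<close> acts trivially on \<open>A\<^sub>q\<close>. Take such an \<open>l\<close> for the largest prime \<open>p\<close>. Counting again, \<open>l\<close>
  acts trivially on each \<open>A\<^sub>q\<close>, except possibly if \<open>p = 3\<close>, \<open>q = 2\<close>, \<open>|A\<^sub>2| = 4\<close> and \<open>l\<close> fixes only
  the identity of \<open>A\<^sub>2\<close>. In that case choose \<open>1 \<noteq> v \<in> A\<^sub>2\<close> acting trivially on \<open>A\<^sub>2\<close>; the commutator of
  \<open>l\<close> and \<open>v\<close> acts trivially on \<open>A\<^sub>2\<close> and \<open>A\<^sub>3\<close>, so it is in the socle. It is not the identity, since if \<open>l\<close> and \<open>v\<close>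
  commute, then \<open>\<lambda>\<^sub>l v - v = \<lambda>\<^sub>v l - l \<in> A\<^sub>2 \<inter> A\<^sub>3 = 0\<close>, so \<open>l\<close> fixes \<open>v\<close>.
\<close>

section \<open>Fixed points and primary parts\<close>

text \<open>Orbit sizes divide \<open>p ^ k\<close>, so every orbit with more than one point has
  size divisible by \<open>p\<close>.\<close>

lemma (in group_action) prime_dvd_card_diff_fixed_points:
  assumes p: "Factorial_Ring.prime p" and ord: "order G = p ^ k" and fin: "finite E"
  shows "p dvd card E - card {x \<in> E. \<forall>g\<in>carrier G. \<phi> g x = x}"
proof -
  define F where "F = {x \<in> E. \<forall>g\<in>carrier G. \<phi> g x = x}"
  \<comment> \<open>Indicator of the points that are not fixed: its sum over an orbit is 0 or the
    size of the orbit, and its sum over \<open>E\<close> counts \<open>E - F\<close>.\<close>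
  define f :: "'c \<Rightarrow> nat" where "f x = (if x \<in> F then 0 else 1)" for x
  interpret group_hom G "BijGroup E" \<phi> by (rule group_hom)
  have "p dvd (\<Sum>x\<in>orb. f x)" if orb: "orb \<in> orbits G E \<phi>" for orb
  proof -
    obtain x where x: "x \<in> E" "orb = orbit G \<phi> x"
      using orb unfolding orbits_def by blast
    have sub: "orb \<subseteq> E"
      using orbits_coverture orb by blast
    show ?thesis
    proof (cases "x \<in> F")
      case True
      then have "orb \<subseteq> {x}" unfolding x orbit_def F_def by auto
      then have "\<forall>y\<in>orb. f y = 0" using True by (auto simp: f_def)
      then show ?thesis by simp
    next
      case False
      have nf: "y \<notin> F" if "y \<in> orb" for y
      proof
        assume y: "y \<in> F"
        have "x \<in> orbit G \<phi> y"
          using orbit_sym[of x y] x that sub by auto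
        then have "x = y" using y unfolding orbit_def F_def by auto
        with y False show False by simp
      qed
      then have sum: "(\<Sum>x\<in>orb. f x) = card orb" by (simp add: f_def)
      have xorb: "x \<in> orb" using orbit_refl x by simp
      obtain g where g: "g \<in> carrier G" "\<phi> g x \<noteq> x" using False x unfolding F_def by blast
      then have "\<phi> g x \<in> orb" unfolding x orbit_def by blast
      then have "card orb \<noteq> 1" using xorb g by (auto simp: card_1_singleton_iff)
      moreover have "card orb dvd p ^ k"
        using orbit_stabilizer_theorem[OF x(1)] ord x(2) by (metis dvd_triv_left)
      ultimately show ?thesis
        unfolding sum using divides_primepow_nat[OF p] by (metis dvd_power power_0 gr0I)
    qed
  qed
  then have "p dvd (\<Sum>orb\<in>orbits G E \<phi>. \<Sum>x\<in>orb. f x)" by (rule dvd_sum)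
  also have "\<dots> = (\<Sum>x\<in>E. f x)" by (rule disjoint_sum[OF fin])
  also have "\<dots> = card (E - F)"
  proof -
    have "(\<Sum>x\<in>E. f x) = (\<Sum>x\<in>E - F. f x)"
      by (rule sum.mono_neutral_right) (auto simp: fin f_def)
    then show ?thesis by (simp add: f_def)
  qed
  also have "\<dots> = card E - card F"
    by (rule card_Diff_subset) (auto simp: F_def fin)
  finally show ?thesis unfolding F_def .
qed

section \<open>Primary parts of a finite abelian group\<close>

lemma (in group) card_subgroup_dvd:
  assumes "finite (carrier G)" "subgroup H G" "subgroup K G" "H \<subseteq> K"
  shows "card H dvd card K"
proof -
  interpret K: group "G\<lparr>carrier := K\<rparr>" using assms(3) by (rule subgroup_imp_group)
  have "subgroup H (G\<lparr>carrier := K\<rparr>)"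
    using assms by (intro subgroup_incl)
  from K.lagrange[OF this] have "card (rcosets\<^bsub>G\<lparr>carrier := K\<rparr>\<^esub> H) * card H = card K"
    by (simp add: order_def)
  then show ?thesis by (metis dvd_triv_right)
qed

text \<open>For a finite abelian group this is the Sylow \<open>q\<close>-subgroup. Using one
  exponent for all elements makes it the kernel of a power map, hence stable under every
  endomorphism.\<close>

definition primary_part :: "('a, 'b) monoid_scheme \<Rightarrow> nat \<Rightarrow> 'a set" where
  "primary_part G q = {x \<in> carrier G. x [^]\<^bsub>G\<^esub> (q ^ multiplicity q (order G)) = \<one>\<^bsub>G\<^esub>}"

lemma (in group) pow_coprime_eq_one:
  assumes x: "x \<in> carrier G" and "x [^] (m::nat) = \<one>" "x [^] (n::nat) = \<one>" "coprime m n"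
  shows "x = \<one>"
proof -
  have "ord x dvd m" "ord x dvd n" using assms pow_eq_id by auto
  then have "ord x = 1" using assms(4) by (metis coprime_common_divisor_nat nat_dvd_1_iff_1)
  then show ?thesis using ord_eq_1[OF x] by simp
qed

lemma (in comm_group) subgroup_primary_part: "subgroup (primary_part G q) G"
  unfolding primary_part_def
  by (rule subgroupI) (auto simp: pow_mult_distrib m_comm nat_pow_inv)

text \<open>A Sylow subgroup lies inside the primary part, which gives one divisibility. Conversely,
  another prime \<open>s\<close> dividing the order of the part would yield a non-trivial element
  killed by both \<open>s\<close> and a power of \<open>q\<close>.\<close>

lemma (in comm_group) card_primary_part:
  assumes fin: "finite (carrier G)" and q: "Factorial_Ring.prime q"
  shows "card (primary_part G q) = q ^ multiplicity q (order G)"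
proof -
  let ?A = "primary_part G q"
  define k where "k = multiplicity q (order G)"
  have n0: "order G \<noteq> 0" using fin order_gt_0_iff_finite by simp
  obtain m where m: "order G = q ^ k * m" unfolding k_def using multiplicity_dvd by blast
  obtain H where H: "subgroup H G" "card H = q ^ k"
    using sylow_thm[OF q _ m fin] is_group by blast
  have "H \<subseteq> ?A"
  proof
    fix x assume x: "x \<in> H"
    have xG: "x \<in> carrier G" using subgroup.mem_carrier[OF H(1) x] .
    interpret H: group "G\<lparr>carrier := H\<rparr>" using H(1) by (rule subgroup_imp_group)
    have "x [^]\<^bsub>G\<lparr>carrier := H\<rparr>\<^esub> order (G\<lparr>carrier := H\<rparr>) = \<one>"
      using H.pow_order_eq_1[of x] x by simp
    then have "x [^] (q ^ k) = \<one>"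
      by (simp add: order_def H(2) nat_pow_def)
    then show "x \<in> ?A" using xG by (simp add: primary_part_def k_def)
  qed
  have A: "subgroup ?A G" by (rule subgroup_primary_part)
  have "card H dvd card ?A" using fin H(1) A \<open>H \<subseteq> ?A\<close> by (rule card_subgroup_dvd)
  then have kA: "q ^ k dvd card ?A" using H(2) by simp
  have An: "card ?A dvd order G"
    using card_subgroup_dvd[OF fin A subgroup_self] subgroup.subset[OF A] by (simp add: order_def)
  have A0: "card ?A \<noteq> 0" using An n0 by auto
  have only: "s = q" if s: "Factorial_Ring.prime s" "s dvd card ?A" for s
  proof (rule ccontr)
    assume neq: "s \<noteq> q"
    interpret A: group "G\<lparr>carrier := ?A\<rparr>" using A by (rule subgroup_imp_group)
    \<comment> \<open>Sylow's theorem with exponent 1 takes the place of Cauchy's theorem.\<close>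
    obtain c where c: "card ?A = s ^ 1 * c" using s(2) by (auto elim: dvdE)
    obtain K where K: "subgroup K (G\<lparr>carrier := ?A\<rparr>)" "card K = s ^ 1"
      using sylow_thm[OF s(1) A.is_group, of 1 c] c A0 by (force simp: order_def card_eq_0_iff)
    have "\<exists>x\<in>K. x \<noteq> \<one>"
    proof (rule ccontr)
      assume "\<not> (\<exists>x\<in>K. x \<noteq> \<one>)"
      then have "K \<subseteq> {\<one>}" by blast
      then have "card K \<le> 1" using card_mono[of "{\<one>}" K] by simp
      then show False using K(2) prime_gt_1_nat[OF s(1)] by simp
    qed
    then obtain x where x: "x \<in> K" "x \<noteq> \<one>" by blast
    have xA: "x \<in> ?A" using subgroup.mem_carrier[OF K(1) x(1)] by simp
    interpret K: group "G\<lparr>carrier := ?A\<rparr>\<lparr>carrier := K\<rparr>" using K(1) by (rule A.subgroup_imp_group)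
    have "x [^]\<^bsub>G\<lparr>carrier := ?A\<rparr>\<lparr>carrier := K\<rparr>\<^esub> order (G\<lparr>carrier := ?A\<rparr>\<lparr>carrier := K\<rparr>) = \<one>"
      using K.pow_order_eq_1[of x] x by simp
    then have "x [^] s = \<one>"
      using K(2) by (simp add: order_def nat_pow_def)
    moreover have "x [^] (q ^ k) = \<one>" "x \<in> carrier G" using xA by (auto simp: primary_part_def k_def)
    moreover have "coprime s (q ^ k)" using primes_coprime[OF s(1) q neq] by simp
    ultimately show False using x(2) pow_coprime_eq_one by blast
  qed
  have "card ?A = q ^ multiplicity q (card ?A)"
  proof -
    have "prime_factors (card ?A) \<subseteq> {q}" using only by (auto simp: prime_factors_dvd)
    then have "(\<Prod>s\<in>prime_factors (card ?A). s ^ multiplicity s (card ?A))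
        = (\<Prod>s\<in>{q}. s ^ multiplicity s (card ?A))"
      by (intro prod.mono_neutral_left) (auto simp: prime_factors_multiplicity q)
    then show ?thesis using A0 prime_factorization_nat[of "card ?A"] by simp
  qed
  moreover have "multiplicity q (card ?A) \<le> k"
    unfolding k_def using An n0 dvd_imp_multiplicity_le by blast
  ultimately show ?thesis
    using kA A0 unfolding k_def[symmetric]
    by (metis dvd_antisym le_imp_power_dvd)
qed

section \<open>Braces of cube-free order\<close>

text \<open>\<open>M\<close> is the multiplicative and \<open>A\<close> the additive group; the
  axiom is a(b + c) = ab - a + ac written without subtraction.\<close>

locale brace = group M + add: comm_group A
  for M :: "'a monoid" (structure) and A :: "'a monoid" +
  assumes carrier_eq: "carrier A = carrier M"
    and left_brace: "\<lbrakk>a \<in> carrier M; b \<in> carrier M; c \<in> carrier M\<rbrakk> \<Longrightarrow>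
      (a \<otimes> (b \<otimes>\<^bsub>A\<^esub> c)) \<otimes>\<^bsub>A\<^esub> a = (a \<otimes> b) \<otimes>\<^bsub>A\<^esub> (a \<otimes> c)"
begin

abbreviation plus (infixl "\<boxplus>" 65) where "x \<boxplus> y \<equiv> x \<otimes>\<^bsub>A\<^esub> y"
abbreviation neg ("\<boxminus> _" [81] 80) where "\<boxminus> x \<equiv> inv\<^bsub>A\<^esub> x"

lemmas add_simps = add.m_closed[unfolded carrier_eq] add.inv_closed[unfolded carrier_eq]
  add.one_closed[unfolded carrier_eq]

declare add_simps [simp, intro]

lemmas add_assoc = add.m_assoc[unfolded carrier_eq]
  and add_comm = add.m_comm[unfolded carrier_eq]
  and add_lcomm = add.m_lcomm[unfolded carrier_eq]
  and add_inv [simp] = add.l_inv[unfolded carrier_eq] add.r_inv[unfolded carrier_eq]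
  and add_zero [simp] = add.l_one[unfolded carrier_eq] add.r_one[unfolded carrier_eq]

lemmas add_ac = add_assoc add_comm add_lcomm

lemma add_cancel [simp]:
  "\<lbrakk>x \<in> carrier M; y \<in> carrier M; z \<in> carrier M\<rbrakk> \<Longrightarrow> x \<boxplus> y = x \<boxplus> z \<longleftrightarrow> y = z"
  by (metis carrier_eq add.inv_solve_left' add_zero(1) add.m_closed)

text \<open>Put a = 1 and b = c = 0 in the brace axiom.\<close>

lemma zero_eq_one: "\<one>\<^bsub>A\<^esub> = \<one>"
proof -
  have "\<one> \<otimes> (\<one>\<^bsub>A\<^esub> \<boxplus> \<one>\<^bsub>A\<^esub>) \<boxplus> \<one> = \<one> \<otimes> \<one>\<^bsub>A\<^esub> \<boxplus> (\<one> \<otimes> \<one>\<^bsub>A\<^esub>)"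
    by (rule left_brace) auto
  then show ?thesis by simp
qed

text \<open>The usual action of the multiplicative group on the additive group by automorphisms; its
  kernel is the socle.\<close>

definition lam :: "'a \<Rightarrow> 'a \<Rightarrow> 'a" where
  "lam a b = \<boxminus> a \<boxplus> a \<otimes> b"

lemma lam_closed [simp, intro]: "a \<in> carrier M \<Longrightarrow> b \<in> carrier M \<Longrightarrow> lam a b \<in> carrier M"
  by (simp add: lam_def)

lemma mult_eq: "a \<in> carrier M \<Longrightarrow> b \<in> carrier M \<Longrightarrow> a \<otimes> b = a \<boxplus> lam a b"
  by (simp add: lam_def flip: add_assoc)

lemma lam_add:
  assumes "a \<in> carrier M" "b \<in> carrier M" "c \<in> carrier M"
  shows "lam a (b \<boxplus> c) = lam a b \<boxplus> lam a c"
proof -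
  have "lam a (b \<boxplus> c) = \<boxminus> a \<boxplus> \<boxminus> a \<boxplus> ((a \<otimes> (b \<boxplus> c)) \<boxplus> a)"
    using assms by (simp add: lam_def add_ac) (simp flip: add_assoc)
  also have "\<dots> = lam a b \<boxplus> lam a c"
    unfolding left_brace[OF assms] using assms by (simp add: lam_def add_ac)
  finally show ?thesis .
qed

text \<open>Expand abc in both bracketings by \<open>mult_eq\<close> and cancel the common
  summand.\<close>

lemma lam_mult:
  assumes "a \<in> carrier M" "b \<in> carrier M" "c \<in> carrier M"
  shows "lam (a \<otimes> b) c = lam a (lam b c)"
proof -
  have "(a \<boxplus> lam a b) \<boxplus> lam (a \<otimes> b) c = (a \<otimes> b) \<otimes> c"
    using assms mult_eq[of "a \<otimes> b" c] mult_eq[of a b] by simp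
  also have "\<dots> = a \<otimes> (b \<otimes> c)" using assms by (simp add: m_assoc)
  also have "\<dots> = a \<boxplus> lam a (b \<boxplus> lam b c)" using assms mult_eq[of a "b \<otimes> c"] mult_eq[of b c] by simp
  also have "\<dots> = (a \<boxplus> lam a b) \<boxplus> lam a (lam b c)" using assms by (simp add: lam_add add_assoc)
  finally show ?thesis using assms by simp
qed

lemma lam_one [simp]: "a \<in> carrier M \<Longrightarrow> lam \<one> a = a"
  using zero_eq_one by (metis add_zero(1) l_one lam_def one_closed add.inv_one)

lemma lam_zero [simp]: "a \<in> carrier M \<Longrightarrow> lam a \<one> = \<one>"
  by (simp add: lam_def zero_eq_one)

lemma lam_inv_lam [simp]: "a \<in> carrier M \<Longrightarrow> x \<in> carrier M \<Longrightarrow> lam (inv a) (lam a x) = x"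
  "a \<in> carrier M \<Longrightarrow> x \<in> carrier M \<Longrightarrow> lam a (lam (inv a) x) = x"
  by (simp_all flip: lam_mult)

lemma lam_hom: "a \<in> carrier M \<Longrightarrow> group_hom A A (lam a)"
  by unfold_locales (auto simp: hom_def carrier_eq lam_add)

lemma lam_inv: "a \<in> carrier M \<Longrightarrow> x \<in> carrier M \<Longrightarrow> lam a (\<boxminus> x) = \<boxminus> lam a x"
  using group_hom.hom_inv[OF lam_hom] carrier_eq by simp

lemma lam_pow: "a \<in> carrier M \<Longrightarrow> x \<in> carrier M \<Longrightarrow> lam a (x [^]\<^bsub>A\<^esub> (n::nat)) = lam a x [^]\<^bsub>A\<^esub> n"
  using group_hom.hom_nat_pow[OF lam_hom] carrier_eq by simp

section \<open>Fixed points of the lambda action\<close>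

definition fix_lam :: "'a set \<Rightarrow> 'a set" where
  "fix_lam H = {x \<in> carrier M. \<forall>h\<in>H. lam h x = x}"

lemma subgroup_fix_lam: "H \<subseteq> carrier M \<Longrightarrow> subgroup (fix_lam H) A"
proof (rule add.subgroupI)
  assume H: "H \<subseteq> carrier M"
  show "fix_lam H \<subseteq> carrier A" by (auto simp: fix_lam_def carrier_eq)
  have "\<one> \<in> fix_lam H" using H by (auto simp: fix_lam_def)
  then show "fix_lam H \<noteq> {}" by blast
  show "\<boxminus> x \<in> fix_lam H" if "x \<in> fix_lam H" for x
    using that H by (auto simp: fix_lam_def lam_inv subset_iff)
  show "x \<boxplus> y \<in> fix_lam H" if "x \<in> fix_lam H" "y \<in> fix_lam H" for x y
    using that H by (auto simp: fix_lam_def lam_add subset_iff)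
qed

text \<open>Makes the orbit count available for any \<open>lam\<close>-invariant set, in particular
  for primary parts.\<close>

lemma lam_action:
  assumes H: "subgroup H M" and E: "E \<subseteq> carrier M"
    and inv: "\<And>h x. h \<in> H \<Longrightarrow> x \<in> E \<Longrightarrow> lam h x \<in> E"
  shows "group_action (M\<lparr>carrier := H\<rparr>) E (\<lambda>h. \<lambda>x\<in>E. lam h x)"
proof -
  interpret H: group "M\<lparr>carrier := H\<rparr>" using H by (rule subgroup_imp_group)
  have HM: "h \<in> carrier M" if "h \<in> H" for h using subgroup.mem_carrier[OF H that] .
  have bij: "(\<lambda>x\<in>E. lam h x) \<in> Bij E" if h: "h \<in> H" for h
  proof -
    have "bij_betw (lam h) E E"
      using h HM E inv[of h] inv[of "inv h"] subgroup.m_inv_closed[OF H, of h]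
      by (intro bij_betw_byWitness[where f' = "lam (inv h)"]) auto
    then show ?thesis
      by (simp add: Bij_def cong: bij_betw_cong)
  qed
  show ?thesis
  proof (intro group_action.intro group_hom.intro group_hom_axioms.intro homI)
    show "group (M\<lparr>carrier := H\<rparr>)" by (rule H.is_group)
    show "group (BijGroup E)" by (rule group_BijGroup)
  next
    fix h assume "h \<in> carrier (M\<lparr>carrier := H\<rparr>)"
    then show "(\<lambda>x\<in>E. lam h x) \<in> carrier (BijGroup E)" by (simp add: BijGroup_def bij)
  next
    fix g h assume "g \<in> carrier (M\<lparr>carrier := H\<rparr>)" "h \<in> carrier (M\<lparr>carrier := H\<rparr>)"
    then have gh: "g \<in> H" "h \<in> H" by simp_all
    have "(\<lambda>x\<in>E. lam (g \<otimes> h) x) = compose E (\<lambda>x\<in>E. lam g x) (\<lambda>x\<in>E. lam h x)"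
      using gh HM E inv by (auto simp: compose_def lam_mult subset_iff)
    then show "(\<lambda>x\<in>E. lam (g \<otimes>\<^bsub>M\<lparr>carrier := H\<rparr>\<^esub> h) x) =
        (\<lambda>x\<in>E. lam g x) \<otimes>\<^bsub>BijGroup E\<^esub> (\<lambda>x\<in>E. lam h x)"
      using gh by (simp add: BijGroup_def bij)
  qed
qed

lemma prime_dvd_card_diff_fix_lam:
  assumes p: "Factorial_Ring.prime p" and fin: "finite (carrier M)"
    and H: "subgroup H M" "card H = p ^ k" and E: "E \<subseteq> carrier M"
    and inv: "\<And>h x. h \<in> H \<Longrightarrow> x \<in> E \<Longrightarrow> lam h x \<in> E"
  shows "p dvd card E - card (E \<inter> fix_lam H)"
proof -
  interpret group_action "M\<lparr>carrier := H\<rparr>" E "\<lambda>h. \<lambda>x\<in>E. lam h x"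
    by (rule lam_action[OF H(1) E inv])
  have "p dvd card E - card {x \<in> E. \<forall>g\<in>carrier (M\<lparr>carrier := H\<rparr>). (\<lambda>x\<in>E. lam g x) x = x}"
    by (rule prime_dvd_card_diff_fixed_points[OF p])
      (use H(2) fin E in \<open>auto simp: order_def intro: finite_subset\<close>)
  also have "{x \<in> E. \<forall>g\<in>carrier (M\<lparr>carrier := H\<rparr>). (\<lambda>x\<in>E. lam g x) x = x} = E \<inter> fix_lam H"
    using E by (auto simp: fix_lam_def)
  finally show ?thesis .
qed

text \<open>Orbit counting needs a group, while the socle argument concerns a single element; this
  passes between the two.\<close>

lemma fix_lam_generate:
  assumes "l \<in> carrier M"
  shows "fix_lam (generate M {l}) = fix_lam {l}"
proof -
  have "lam h x = x" if x: "x \<in> fix_lam {l}" and h: "h \<in> generate M {l}" for x h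
    using h
  proof induction
    case (inv h)
    then show ?case using x assms lam_inv_lam(1)[of l x] by (auto simp: fix_lam_def)
  next
    case (eng g h)
    then show ?case using x assms generate_in_carrier[of "{l}"]
      by (auto simp: fix_lam_def lam_mult)
  qed (use x in \<open>auto simp: fix_lam_def\<close>)
  then show ?thesis by (auto simp: fix_lam_def intro: generate.incl)
qed

section \<open>Primary parts of the additive group inside the brace\<close>

lemma order_eq: "order A = order M"
  by (simp add: order_def carrier_eq)

lemma primary_part_subset: "primary_part A q \<subseteq> carrier M"
  by (auto simp: primary_part_def carrier_eq)

lemma lam_primary_part:
  assumes "a \<in> carrier M" "x \<in> primary_part A q"
  shows "lam a x \<in> primary_part A q"
  using assms group_hom.hom_one[OF lam_hom[of a]]
  by (auto simp: primary_part_def carrier_eq simp flip: lam_pow)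

text \<open>An additive subgroup invariant under \<open>lam\<close> is closed under products because
  ab = a + \<open>lam a b\<close>, and under inverses because \<open>inv a\<close> is the image of
  -a under \<open>lam (inv a)\<close>.\<close>

lemma subgroup_mult_primary_part: "subgroup (primary_part A q) M"
proof (rule subgroupI)
  interpret A: subgroup "primary_part A q" A by (rule add.subgroup_primary_part)
  show sub: "primary_part A q \<subseteq> carrier M" by (rule primary_part_subset)
  show "primary_part A q \<noteq> {}" using A.one_closed by blast
  show "a \<otimes> b \<in> primary_part A q" if "a \<in> primary_part A q" "b \<in> primary_part A q" for a b
    using that sub lam_primary_part[of a b q] A.m_closed[of a "lam a b"] by (auto simp: mult_eq subset_iff)
  show "inv a \<in> primary_part A q" if a: "a \<in> primary_part A q" for a
  proof -
    have aM: "a \<in> carrier M" using a sub by blast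
    have "a \<boxplus> lam a (inv a) = \<one>\<^bsub>A\<^esub>" using mult_eq[of a "inv a"] aM zero_eq_one by simp
    then have "lam a (inv a) = \<boxminus> a"
      using aM by (metis add.inv_equality add.inv_inv add_comm carrier_eq inv_closed lam_closed)
    then have "inv a = lam (inv a) (\<boxminus> a)" using aM lam_inv_lam(1)[of a "inv a"] by simp
    then show ?thesis using lam_primary_part[of "inv a" "\<boxminus> a" q] A.m_inv_closed[OF a] aM by simp
  qed
qed

lemma card_inter_fix_lam_dvd:
  assumes "finite (carrier M)" "subgroup E A" "H \<subseteq> carrier M"
  shows "card (E \<inter> fix_lam H) dvd card E"
  using assms add.card_subgroup_dvd[of "E \<inter> fix_lam H" E]
    add.subgroups_Inter_pair[OF assms(2) subgroup_fix_lam[OF assms(3)]]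
  by (simp add: carrier_eq)

text \<open>The fixed points form an additive subgroup; containing all primary parts, its order is
  divisible by every prime power in the group order.\<close>

lemma fix_lam_eq_carrier:
  assumes fin: "finite (carrier M)" and H: "H \<subseteq> carrier M"
    and fixed: "\<And>q. Factorial_Ring.prime q \<Longrightarrow> q dvd order M \<Longrightarrow> primary_part A q \<subseteq> fix_lam H"
  shows "fix_lam H = carrier M"
proof -
  have F: "subgroup (fix_lam H) A" using H by (rule subgroup_fix_lam)
  have sub: "fix_lam H \<subseteq> carrier M" by (auto simp: fix_lam_def)
  have fin': "finite (carrier A)" using fin by (simp add: carrier_eq)
  have n0: "order M \<noteq> 0" using fin order_gt_0_iff_finite by simp
  have F0: "card (fix_lam H) \<noteq> 0"
    using subgroup.finite_imp_card_positive[OF F] fin' by simp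
  have "order M dvd card (fix_lam H)"
  proof (rule multiplicity_le_imp_dvd)
    show "order M \<noteq> 0" by (rule n0)
    fix q :: nat assume q: "Factorial_Ring.prime q"
    show "multiplicity q (order M) \<le> multiplicity q (card (fix_lam H))"
    proof (cases "q dvd order M")
      case True
      have "card (primary_part A q) dvd card (fix_lam H)"
        by (rule add.card_subgroup_dvd[OF fin' add.subgroup_primary_part F fixed[OF q True]])
      then have "q ^ multiplicity q (order M) dvd card (fix_lam H)"
        using add.card_primary_part[OF fin' q] by (simp add: order_eq)
      then show ?thesis using F0 q by (intro multiplicity_geI) auto
    qed (simp add: not_dvd_imp_multiplicity_0)
  qed
  then have "card (carrier M) \<le> card (fix_lam H)" using F0 by (auto simp: order_def dest: dvd_imp_le)
  then show ?thesis using sub fin by (metis card_seteq)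
qed

text \<open>If the part fixes itself pointwise, any non-trivial element will do. Otherwise an
  element stabilising a point outside the common fixed set \<open>F\<close> has more than
  \<open>q\<close> fixed points, hence all \<open>q ^ 2\<close>.\<close>

lemma ex_trivial_on_primary_part:
  assumes fin: "finite (carrier M)" and q: "Factorial_Ring.prime q"
    and k: "multiplicity q (order M) \<in> {1, 2}"
  obtains l where "l \<in> primary_part A q" "l \<noteq> \<one>" "primary_part A q \<subseteq> fix_lam {l}"
proof -
  let ?P = "primary_part A q"
  define k where "k = multiplicity q (order M)"
  have q1: "q > 1" using q prime_gt_1_nat by simp
  have P: "card ?P = q ^ k"
    using add.card_primary_part[OF _ q] fin by (simp add: carrier_eq order_eq k_def)
  have finP: "finite ?P" using fin primary_part_subset finite_subset by blast
  have subM: "subgroup ?P M" by (rule subgroup_mult_primary_part)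
  have subA: "subgroup ?P A" by (rule add.subgroup_primary_part)
  have PM: "x \<in> carrier M" if "x \<in> ?P" for x using that primary_part_subset by blast
  define F where "F = ?P \<inter> fix_lam ?P"
  have "q dvd card ?P - card F"
    unfolding F_def by (rule prime_dvd_card_diff_fix_lam[OF q fin subM P])
      (auto simp: PM lam_primary_part)
  moreover have "q dvd card ?P" using k P unfolding k_def by auto
  moreover have "card F \<le> card ?P" using finP by (auto simp: F_def intro: card_mono)
  ultimately have qF: "q dvd card F" by (metis dvd_diffD1)
  \<comment> \<open>A positive multiple of \<open>q\<close> is at least \<open>q\<close>, so one
    known fixed point produces \<open>q\<close> of them.\<close>
  have "\<one> \<in> F" using subgroup.one_closed[OF subM] PM by (auto simp: F_def fix_lam_def)
  then have F0: "card F > 0" using finP by (auto simp: F_def card_gt_0_iff)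
  then have Fq: "card F \<ge> q" using qF by (simp add: dvd_imp_le)
  show ?thesis
  proof (cases "F = ?P")
    case True
    have "card ?P > 1" using Fq q1 True by simp
    then obtain l where "l \<in> ?P" "l \<noteq> \<one>"
      by (metis card.empty card_mono finite.emptyI is_singletonI is_singleton_altdef less_irrefl 
          not_one_less_zero subsetI subset_singletonD singletonI)
    then show ?thesis using that True by (auto simp: F_def fix_lam_def)
  next
    case False
    then obtain x where x: "x \<in> ?P" "x \<notin> F" by (auto simp: F_def)
    have "lam g x \<in> ?P - F" if g: "g \<in> ?P" for g
    proof -
      have "lam g x \<notin> F"
      proof
        assume "lam g x \<in> F"
        then have "lam (inv g) (lam g x) = lam g x"
          using subgroup.m_inv_closed[OF subM g] by (auto simp: F_def fix_lam_def)
        then have "lam g x = x" using g x PM by simp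
        with \<open>lam g x \<in> F\<close> x show False by simp
      qed
      then show ?thesis using lam_primary_part g x PM by blast
    qed
    \<comment> \<open>Pigeonhole: the orbit of \<open>x\<close> stays outside \<open>F\<close>, so
      two elements of the part send \<open>x\<close> to the same point and their quotient
      \<open>l\<close> stabilises \<open>x\<close>.\<close>
    moreover have "card (?P - F) < card ?P"
      using F0 finP \<open>card F \<le> card ?P\<close> card_Diff_subset[of F ?P] by (simp add: F_def)
    ultimately have "\<not> inj_on (\<lambda>g. lam g x) ?P"
      using finP by (metis card_inj_on_le finite_Diff image_subsetI linorder_not_less)
    then obtain g h where gh: "g \<in> ?P" "h \<in> ?P" "g \<noteq> h" "lam g x = lam h x"
      by (auto simp: inj_on_def)
    define l where "l = inv g \<otimes> h"
    have l: "l \<in> ?P" using gh subgroup.m_inv_closed[OF subM] subgroup.m_closed[OF subM] by (simp add: l_def)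
    have l1: "l \<noteq> \<one>" using gh PM by (auto simp: l_def inv_solve_left' dest: inv_equality)
    have xl: "x \<in> fix_lam {l}"
      using gh x PM lam_inv_lam(1)[of g x] by (auto simp: fix_lam_def l_def lam_mult)
    define C where "C = ?P \<inter> fix_lam {l}"
    have "insert x F \<subseteq> C" using xl x l by (auto simp: C_def F_def fix_lam_def)
    moreover have "finite C" using finP by (simp add: C_def)
    ultimately have "card (insert x F) \<le> card C" by (simp add: card_mono)
    then have Cq: "card C > q" using Fq x finP by (simp add: F_def)
    \<comment> \<open>The fixed set of \<open>l\<close> in the part is a subgroup with more than
      \<open>q\<close> elements, so its order can only be \<open>q ^ k\<close>.\<close>
    have "card C dvd q ^ k"
      using card_inter_fix_lam_dvd[OF fin subA, of "{l}"] l PM P by (simp add: C_def)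
    then obtain i where i: "i \<le> k" "card C = q ^ i" using divides_primepow_nat[OF q] by blast
    have "i \<noteq> 0" using Cq i q1 by (cases "i = 0") simp_all
    moreover have "i \<noteq> 1" using Cq i by auto
    ultimately have "i = k" using i k unfolding k_def by auto
    then have "C = ?P" using i P finP by (intro card_subset_eq) (auto simp: C_def)
    then show ?thesis using that l l1 by (auto simp: C_def)
  qed
qed

end

text \<open>
  For the largest prime divisor \<open>p\<close>, an element of the \<open>p\<close>-part can act non-trivially on another
  primary part only if \<open>p = 3\<close> and the \<open>2\<close>-part has four elements.
\<close>

lemma fixed_point_count_cases:
  fixes p q :: nat
  assumes p: "Factorial_Ring.prime p" and q: "Factorial_Ring.prime q" and "q < p"
    and j: "j \<le> 2" and f: "f dvd q ^ j" and d: "p dvd q ^ j - f"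
  shows "f = q ^ j \<or> (q = 2 \<and> p = 3 \<and> f = 1)"
proof -
  obtain i where i: "i \<le> j" "f = q ^ i" using f divides_primepow_nat[OF q] by blast
  have q1: "q > 1" using q prime_gt_1_nat by simp
  have small: "\<not> p dvd q" "\<not> p dvd q - 1"
    using \<open>q < p\<close> q1 by (auto dest: dvd_imp_le)
  have "i = j \<or> (i = 0 \<and> j = 1) \<or> (i = 0 \<and> j = 2) \<or> (i = 1 \<and> j = 2)" using i j by auto
  then consider "i = j" | "i = 0" "j = 1" | "i = 0" "j = 2" | "i = 1" "j = 2" by blast
  then show ?thesis
  proof cases
    case 3
    \<comment> \<open>As \<open>p > q\<close> cannot divide \<open>q - 1\<close>, it divides
      \<open>q + 1\<close>, so \<open>p = q + 1\<close>; the only consecutive primes are 2 and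
      3.\<close>
    have "q ^ j - f = (q - 1) * (q + 1)"
      using 3 i by (simp add: power2_eq_square algebra_simps)
    then have "p dvd q + 1" using d small by (metis p prime_dvd_mult_iff)
    then have pq: "p = q + 1" using \<open>q < p\<close> by (auto dest: dvd_imp_le)
    then have "even q \<or> even p" by simp
    then have "q = 2"
      using p q pq q1 by (metis add_diff_cancel_right' nat_neq_iff not_less_eq One_nat_def Suc_1 add.commute plus_1_eq_Suc primes_dvd_imp_eq two_is_prime_nat)
    then show ?thesis using pq 3 i by simp
  next
    case 4
    then have "q ^ j - f = q * (q - 1)"
      using i by (simp add: power2_eq_square algebra_simps)
    then show ?thesis using d p small by (simp add: prime_dvd_mult_iff)
  qed (use i d small in auto)
qed

theorem (in brace) ex_nontrivial_socle:
  assumes fin: "finite (carrier M)" and cf: "cube_free (order M)" and n1: "order M \<noteq> 1"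
  obtains l where "l \<in> carrier M" "l \<noteq> \<one>" "fix_lam {l} = carrier M"
proof -
  note concl = that
  let ?P = "primary_part A"
  define n where "n = order M"
  have n0: "n > 0" using fin order_gt_0_iff_finite by (simp add: n_def)
  have finA: "finite (carrier A)" using fin by (simp add: carrier_eq)
  have mult2: "multiplicity q n \<le> 2" if "Factorial_Ring.prime q" for q
  proof -
    have "\<not> q ^ 3 dvd n" using cf that by (simp add: cube_free_def n_def)
    then show ?thesis using multiplicity_dvd'[of 3 q n] by linarith
  qed
  have mult1: "multiplicity q n \<in> {1, 2}" if "q \<in> prime_factors n" for q
    using mult2[of q] that by (auto simp: prime_factors_multiplicity)
  have cardP: "card (?P q) = q ^ multiplicity q n" if "Factorial_Ring.prime q" for q
    using add.card_primary_part[OF finA that] by (simp add: order_eq n_def)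
  have PM: "x \<in> carrier M" if "x \<in> ?P q" for x q using that primary_part_subset by blast
  \<comment> \<open>Distinct primary parts meet trivially, since their exponents are
    coprime.\<close>
  have disj: "x = \<one>" if "x \<in> ?P q" "x \<in> ?P s" "Factorial_Ring.prime q" "Factorial_Ring.prime s" "q \<noteq> s" for x q s
    using that add.pow_coprime_eq_one[of x "q ^ multiplicity q n" "s ^ multiplicity s n"] primes_coprime[of q s]
    by (auto simp: primary_part_def order_eq n_def zero_eq_one)
  define p where "p = Max (prime_factors n)"
  have "prime_factors n \<noteq> {}" using n0 n1 by (simp add: n_def prime_factorization_empty_iff)
  then have pp: "p \<in> prime_factors n" unfolding p_def by (intro Max_in) auto
  then have p: "Factorial_Ring.prime p" by (rule in_prime_factors_imp_prime)
  obtain l where l: "l \<in> ?P p" "l \<noteq> \<one>" "?P p \<subseteq> fix_lam {l}"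
    using ex_trivial_on_primary_part[OF fin p] mult1[OF pp] unfolding n_def by blast
  have lM: "l \<in> carrier M" using l PM by blast
  have cases: "?P q \<subseteq> fix_lam {l} \<or> (q = 2 \<and> p = 3 \<and> card (?P q \<inter> fix_lam {l}) = 1)"
    if q: "q \<in> prime_factors n" for q
  proof (cases "q = p")
    case False
    then have "q < p" using q unfolding p_def by (simp add: le_neq_implies_less)
    have pq: "Factorial_Ring.prime q" using q by auto
    \<comment> \<open>The cyclic group generated by \<open>l\<close> lies in the
      \<open>p\<close>-part, so it is a \<open>p\<close>-group and its non-trivial orbits on the
      \<open>q\<close>-part have size divisible by \<open>p\<close>.\<close>
    let ?H = "generate M {l}" and ?f = "card (?P q \<inter> fix_lam {l})"
    have H: "subgroup ?H M" using lM by (intro generate_is_subgroup) auto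
    have "?H \<subseteq> ?P p" using l(1) by (intro generate_subgroup_incl subgroup_mult_primary_part) auto
    then have "card ?H dvd p ^ multiplicity p n"
      using card_subgroup_dvd[OF fin H subgroup_mult_primary_part] cardP[OF p] by metis
    then obtain i where i: "card ?H = p ^ i" using divides_primepow_nat[OF p] by blast
    have "p dvd card (?P q) - card (?P q \<inter> fix_lam ?H)"
      using subgroup.subset[OF H] lam_primary_part
      by (intro prime_dvd_card_diff_fix_lam[OF p fin H i]) (auto simp: PM)
    then have d: "p dvd q ^ multiplicity q n - ?f"
      using cardP[OF pq] fix_lam_generate[OF lM] by simp
    have f: "?f dvd q ^ multiplicity q n"
      using card_inter_fix_lam_dvd[OF fin add.subgroup_primary_part, of "{l}" q] lM cardP[OF pq] by simp
    from fixed_point_count_cases[OF p pq \<open>q < p\<close> mult2[OF pq] f d]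
    show ?thesis
    proof
      assume "?f = q ^ multiplicity q n"
      then have "?P q \<inter> fix_lam {l} = ?P q"
        using cardP[OF pq] fin primary_part_subset[of q] by (intro card_subset_eq) (auto intro: finite_subset)
      then show ?thesis by blast
    qed blast
  qed (use l in auto)
  have done_if: thesis if "h \<in> carrier M" "h \<noteq> \<one>" "\<And>q. q \<in> prime_factors n \<Longrightarrow> ?P q \<subseteq> fix_lam {h}" for h
  proof (rule concl)
    show "h \<in> carrier M" "h \<noteq> \<one>" by fact+
    show "fix_lam {h} = carrier M"
      using that(3) n0 by (intro fix_lam_eq_carrier fin) (auto simp: n_def \<open>h \<in> carrier M\<close> in_prime_factors_iff)
  qed
  show thesis
  proof (cases "\<forall>q\<in>prime_factors n. ?P q \<subseteq> fix_lam {l}")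
    case True
    then show thesis using done_if lM l by blast
  next
    case False
    then have two: "2 \<in> prime_factors n" and p3: "p = 3" and f1: "card (?P 2 \<inter> fix_lam {l}) = 1"
      using cases by blast+
    \<comment> \<open>The largest prime divisor is 3, so only two primary parts remain to be
      checked.\<close>
    have only: "q = 2 \<or> q = 3" if "q \<in> prime_factors n" for q
      using cases[OF that] p3 that Max_ge[of "prime_factors n" q] prime_ge_2_nat[of q]
      unfolding p_def[symmetric] by (auto simp: in_prime_factors_iff)
    have p2: "Factorial_Ring.prime (2::nat)" by simp
    obtain v where v: "v \<in> ?P 2" "v \<noteq> \<one>" "?P 2 \<subseteq> fix_lam {v}"
      using ex_trivial_on_primary_part[OF fin p2] mult1[OF two] unfolding n_def by blast
    have vM: "v \<in> carrier M" using v PM by blast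
    \<comment> \<open>A commutator of \<open>l\<close> and \<open>v\<close>. On the 2-part
      \<open>v\<close> acts trivially and on the 3-part \<open>l\<close> does, so on both parts the
      two actions commute and \<open>c\<close> acts trivially.\<close>
    define c where "c = inv (v \<otimes> l) \<otimes> (l \<otimes> v)"
    have cM: "c \<in> carrier M" using lM vM by (simp add: c_def)
    have comm: "lam l (lam v x) = lam v (lam l x)" if "x \<in> ?P 2 \<or> x \<in> ?P 3" for x
      using that l(3) v(3) lam_primary_part[OF lM, of x] lam_primary_part[OF vM, of x] p3
      by (auto simp: fix_lam_def subset_iff)
    have "lam c x = x" if x: "x \<in> ?P 2 \<or> x \<in> ?P 3" for x
    proof -
      have xM: "x \<in> carrier M" using x PM by blast
      have "lam c x = lam (inv (v \<otimes> l)) (lam (l \<otimes> v) x)"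
        using lM vM xM unfolding c_def by (intro lam_mult) auto
      also have "lam (l \<otimes> v) x = lam (v \<otimes> l) x" using comm[OF x] lM vM xM by (simp add: lam_mult)
      finally show ?thesis using lM vM xM by simp
    qed
    then have cfix: "?P q \<subseteq> fix_lam {c}" if "q \<in> prime_factors n" for q
      using only[OF that] PM by (auto simp: fix_lam_def)
    have "c \<noteq> \<one>"
    proof
      assume "c = \<one>"
      then have "l \<otimes> v = v \<otimes> l"
        using lM vM unfolding c_def by (metis inv_closed inv_inv inv_unique' m_closed inv_equality)
      then have eq: "l \<boxplus> lam l v = v \<boxplus> lam v l" using lM vM by (simp flip: mult_eq)
      \<comment> \<open>Comparing lv with vl additively writes \<open>d\<close> also as -l +
        \<open>lam v l\<close>. The first form lies in the 2-part and the second in the 3-part, so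
        \<open>d\<close> vanishes.\<close>
      define d where "d = lam l v \<boxplus> \<boxminus> v"
      have "l \<boxplus> d = lam v l"
        using arg_cong[OF eq, of "\<lambda>t. t \<boxplus> \<boxminus> v"] lM vM add_assoc[of v "\<boxminus> v" "lam v l"]
        by (simp add: d_def add_ac)
      then have d2: "d = \<boxminus> l \<boxplus> lam v l"
        using lM vM by (metis add.inv_solve_left carrier_eq d_def lam_closed add_simps(1,2))
      have "d \<in> ?P 2"
        unfolding d_def using v(1) lam_primary_part[OF lM]
          subgroup.m_closed[OF add.subgroup_primary_part] subgroup.m_inv_closed[OF add.subgroup_primary_part] by blast
      moreover have "d \<in> ?P 3"
        unfolding d2 using l(1) lam_primary_part[OF vM] p3
          subgroup.m_closed[OF add.subgroup_primary_part] subgroup.m_inv_closed[OF add.subgroup_primary_part] by blast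
      ultimately have "d = \<one>" using disj[of d 2 3] by simp
      then have "lam l v = v"
        using lM vM unfolding d_def by (metis add.inv_equality add.inv_inv carrier_eq zero_eq_one lam_closed add.inv_closed)
      \<comment> \<open>Two fixed points of \<open>l\<close> in the 2-part contradict
        \<open>f1\<close>.\<close>
      then have "{\<one>, v} \<subseteq> ?P 2 \<inter> fix_lam {l}"
        using v(1) vM lM subgroup.one_closed[OF subgroup_mult_primary_part] by (auto simp: fix_lam_def)
      moreover have "finite (?P 2 \<inter> fix_lam {l})" using fin primary_part_subset finite_subset by blast
      ultimately have "card {\<one>, v} \<le> 1" using f1 card_mono by metis
      then show False using v(2) by simp
    qed
    then show thesis using done_if cM cfix by blast
  qed
qed

section \<open>The brace of the permutation group\<close>

lemma (in group) generate_commute_one: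
  assumes z: "z \<in> carrier G" and S: "S \<subseteq> carrier G"
    and comm: "\<And>s. s \<in> S \<Longrightarrow> z \<otimes> s = s \<otimes> z" and t: "t \<in> generate G S"
  shows "z \<otimes> t = t \<otimes> z"
  using t
proof induction
  case (inv h)
  then have h: "h \<in> carrier G" "z \<otimes> h = h \<otimes> z" using S comm by auto
  have "z \<otimes> inv h = inv h \<otimes> (h \<otimes> z) \<otimes> inv h" using h(1) z by (simp flip: m_assoc)
  also have "\<dots> = inv h \<otimes> z" unfolding h(2)[symmetric] using h(1) z by (simp add: m_assoc)
  finally show ?case .
next
  case (eng g h)
  then have "g \<in> carrier G" "h \<in> carrier G" using generate_in_carrier[OF S] by auto
  then show ?case using eng z by (metis m_assoc)
qed (use z comm in auto)

text \<open>Two passes of the centraliser argument: first \<open>s\<close> against each generator,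
  then \<open>s\<close> against \<open>t\<close>.\<close>

lemma (in group) generate_comm:
  assumes S: "S \<subseteq> carrier G" and comm: "\<And>s t. s \<in> S \<Longrightarrow> t \<in> S \<Longrightarrow> s \<otimes> t = t \<otimes> s"
    and st: "s \<in> generate G S" "t \<in> generate G S"
  shows "s \<otimes> t = t \<otimes> s"
proof (rule generate_commute_one[OF _ S _ st(2)])
  show "s \<in> carrier G" using generate_in_carrier[OF S st(1)] .
  fix t assume t: "t \<in> S"
  have "t \<otimes> s = s \<otimes> t"
    using t S by (intro generate_commute_one[OF _ S _ st(1)] comm) auto
  then show "s \<otimes> t = t \<otimes> s" by simp
qed

section \<open>Pointwise evaluation in symmetric groups\<close>

lemma carrier_BijGroup: "carrier (BijGroup S) = Bij S"
  by (simp add: BijGroup_def)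

lemma BijGroup_one_apply: "x \<in> S \<Longrightarrow> \<one>\<^bsub>BijGroup S\<^esub> x = x"
  by (simp add: BijGroup_def)

lemma BijGroup_mult_apply:
  "f \<in> Bij S \<Longrightarrow> g \<in> Bij S \<Longrightarrow> x \<in> S \<Longrightarrow> (f \<otimes>\<^bsub>BijGroup S\<^esub> g) x = f (g x)"
  by (simp add: BijGroup_def compose_eq)

lemma Bij_apply_closed: "f \<in> Bij S \<Longrightarrow> x \<in> S \<Longrightarrow> f x \<in> S"
  by (auto simp: Bij_def bij_betw_def)

lemma BijGroup_inv_Bij: "f \<in> Bij S \<Longrightarrow> inv\<^bsub>BijGroup S\<^esub> f \<in> Bij S"
  using group.inv_closed[OF group_BijGroup, of f S] by (simp add: carrier_BijGroup)

lemma BijGroup_inv_apply: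
  assumes "f \<in> Bij S" "x \<in> S"
  shows "f ((inv\<^bsub>BijGroup S\<^esub> f) x) = x" "(inv\<^bsub>BijGroup S\<^esub> f) (f x) = x"
  using BijGroup_mult_apply[of f S "inv\<^bsub>BijGroup S\<^esub> f" x] BijGroup_mult_apply[of "inv\<^bsub>BijGroup S\<^esub> f" S f x]
    group.r_inv[OF group_BijGroup, of f S] group.l_inv[OF group_BijGroup, of f S] assms
  by (simp_all add: carrier_BijGroup BijGroup_inv_Bij BijGroup_one_apply)

section \<open>Braces from regular abelian permutation groups\<close>

text \<open>A transitive abelian permutation group is regular, so evaluation at the identity
  identifies \<open>K\<close> with the carrier and transports an abelian group structure to it.
  Normalisation by left multiplications becomes the brace axiom.\<close>

locale regular_abelian = group M for M :: "'a monoid" (structure) +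
  fixes K :: "('a \<Rightarrow> 'a) set"
  assumes subgroup_K: "subgroup K (BijGroup (carrier M))"
    and comm: "\<lbrakk>s \<in> K; t \<in> K; x \<in> carrier M\<rbrakk> \<Longrightarrow> s (t x) = t (s x)"
    and transitive: "g \<in> carrier M \<Longrightarrow> \<exists>t\<in>K. t \<one> = g"
    and normalized: "\<lbrakk>g \<in> carrier M; t \<in> K\<rbrakk> \<Longrightarrow> \<exists>s\<in>K. \<forall>x\<in>carrier M. g \<otimes> t x = s (g \<otimes> x)"
begin

text \<open>Translation by \<open>g\<close> in the additive group; the choice is unique on the
  carrier by \<open>eq_if_eq_at_one\<close>.\<close>

definition shift :: "'a \<Rightarrow> 'a \<Rightarrow> 'a" where
  "shift g = (SOME t. t \<in> K \<and> t \<one> = g)"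

definition add_group :: "'a monoid" where
  "add_group = \<lparr>carrier = carrier M, monoid.mult = shift, one = \<one>\<rparr>"

lemma K_Bij: "t \<in> K \<Longrightarrow> t \<in> Bij (carrier M)"
  using subgroup.mem_carrier[OF subgroup_K] by (simp add: carrier_BijGroup)

lemma K_closed [simp]: "t \<in> K \<Longrightarrow> x \<in> carrier M \<Longrightarrow> t x \<in> carrier M"
  by (rule Bij_apply_closed[OF K_Bij])

lemma shift: "g \<in> carrier M \<Longrightarrow> shift g \<in> K" "g \<in> carrier M \<Longrightarrow> shift g \<one> = g"
  using someI_ex[OF transitive[of g, unfolded Bex_def]] unfolding shift_def by auto

lemma shift_closed [simp, intro]: "g \<in> carrier M \<Longrightarrow> x \<in> carrier M \<Longrightarrow> shift g x \<in> carrier M"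
  by (rule K_closed[OF shift(1)])

text \<open>Write x as \<open>u \<one>\<close> with \<open>u\<close> in \<open>K\<close> and move
  \<open>u\<close> past \<open>s\<close> and \<open>t\<close>.\<close>

lemma eq_if_eq_at_one:
  assumes "s \<in> K" "t \<in> K" "s \<one> = t \<one>" "x \<in> carrier M"
  shows "s x = t x"
proof -
  obtain u where u: "u \<in> K" "u \<one> = x" using transitive assms(4) by blast
  have "s x = u (s \<one>)" using comm[of s u \<one>] assms u by simp
  also have "\<dots> = t x" using comm[of t u \<one>] assms u by simp
  finally show ?thesis .
qed

lemma shift_apply:
  assumes "t \<in> K" "x \<in> carrier M"
  shows "shift (t \<one>) x = t x"
  using assms eq_if_eq_at_one[of "shift (t \<one>)" t x] shift[of "t \<one>"] by simp

lemma K_comp: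
  assumes "s \<in> K" "t \<in> K"
  obtains u where "u \<in> K" "\<And>x. x \<in> carrier M \<Longrightarrow> u x = s (t x)"
  using subgroup.m_closed[OF subgroup_K assms] BijGroup_mult_apply[OF K_Bij K_Bij] assms by blast

text \<open>Both sides come from elements of \<open>K\<close> that agree at the identity; this
  yields associativity.\<close>

lemma shift_comp:
  assumes "s \<in> K" "g \<in> carrier M" "x \<in> carrier M"
  shows "shift (s g) x = s (shift g x)"
proof -
  obtain u where "u \<in> K" "\<And>x. x \<in> carrier M \<Longrightarrow> u x = s (shift g x)"
    using K_comp[OF assms(1) shift(1)[OF assms(2)]] by blast
  then show ?thesis using shift_apply[of u x] shift(2) assms by simp
qed

lemma comm_group_add_group: "comm_group add_group"
proof (rule comm_groupI)
  fix x y z assume xyz: "x \<in> carrier add_group" "y \<in> carrier add_group" "z \<in> carrier add_group"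
  then show "x \<otimes>\<^bsub>add_group\<^esub> y \<otimes>\<^bsub>add_group\<^esub> z = x \<otimes>\<^bsub>add_group\<^esub> (y \<otimes>\<^bsub>add_group\<^esub> z)"
    using shift_comp[of "shift x" y z] shift(1)[of x] by (simp add: add_group_def)
next
  fix x y assume xy: "x \<in> carrier add_group" "y \<in> carrier add_group"
  then show "x \<otimes>\<^bsub>add_group\<^esub> y \<in> carrier add_group" by (simp add: add_group_def)
  show "x \<otimes>\<^bsub>add_group\<^esub> y = y \<otimes>\<^bsub>add_group\<^esub> x"
    using xy comm[of "shift x" "shift y" \<one>] shift[of x] shift[of y] by (simp add: add_group_def)
next
  show "\<one>\<^bsub>add_group\<^esub> \<in> carrier add_group" by (simp add: add_group_def)
next
  fix x assume x: "x \<in> carrier add_group"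
  let ?e = "\<one>\<^bsub>BijGroup (carrier M)\<^esub>"
  have "?e \<in> K" by (rule subgroup.one_closed[OF subgroup_K])
  then show "\<one>\<^bsub>add_group\<^esub> \<otimes>\<^bsub>add_group\<^esub> x = x"
    using x shift_apply[of ?e x] by (simp add: add_group_def BijGroup_one_apply)
  let ?s = "inv\<^bsub>BijGroup (carrier M)\<^esub> (shift x)"
  have s: "?s \<in> K" using subgroup.m_inv_closed[OF subgroup_K] shift(1) x by (simp add: add_group_def)
  have "shift (?s \<one>) x = \<one>"
    using shift_apply[OF s, of x] BijGroup_inv_apply(2)[OF K_Bij[OF shift(1)], of x \<one>] shift(2)[of x] x
    by (simp add: add_group_def)
  then show "\<exists>y\<in>carrier add_group. y \<otimes>\<^bsub>add_group\<^esub> x = \<one>\<^bsub>add_group\<^esub>"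
    using s by (auto simp: add_group_def)
qed

sublocale brace M add_group
proof (intro brace.intro brace_axioms.intro)
  show "group M" by (rule is_group)
  show "comm_group add_group" by (rule comm_group_add_group)
  show "carrier add_group = carrier M" by (simp add: add_group_def)
  fix a b c assume abc: "a \<in> carrier M" "b \<in> carrier M" "c \<in> carrier M"
  \<comment> \<open>\<open>s\<close> and \<open>t\<close> are the conjugates of
    \<open>shift b\<close> and \<open>shift c\<close> by left multiplication with \<open>a\<close>.
    Evaluating at the identity gives ab = \<open>s a\<close> and ac = \<open>t a\<close>, and both
    sides of the axiom become \<open>s (shift a (t a))\<close>.\<close>
  obtain s where s: "s \<in> K" "\<And>x. x \<in> carrier M \<Longrightarrow> a \<otimes> shift b x = s (a \<otimes> x)"
    using normalized[OF abc(1) shift(1)[OF abc(2)]] by blast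
  obtain t where t: "t \<in> K" "\<And>x. x \<in> carrier M \<Longrightarrow> a \<otimes> shift c x = t (a \<otimes> x)"
    using normalized[OF abc(1) shift(1)[OF abc(3)]] by blast
  have ab: "a \<otimes> b = s a" and ac: "a \<otimes> c = t a"
    using s(2)[of \<one>] t(2)[of \<one>] abc shift(2) by auto
  have "a \<otimes> shift b c = s (t a)" using s(2)[of c] ac abc by simp
  then have "shift (a \<otimes> shift b c) a = s (shift (t a) a)"
    using shift_comp[of s "t a" a] s t abc by simp
  also have "shift (t a) a = shift a (t a)"
    using comm_group.axioms(1)[OF comm_group_add_group, THEN comm_monoid.m_comm, of "t a" a] t(1) abc
    by (simp add: add_group_def)
  also have "s (shift a (t a)) = shift (a \<otimes> b) (a \<otimes> c)"
    using shift_comp[of s a "t a"] s t abc ab ac by simp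
  finally show "a \<otimes> (b \<otimes>\<^bsub>add_group\<^esub> c) \<otimes>\<^bsub>add_group\<^esub> a = a \<otimes> b \<otimes>\<^bsub>add_group\<^esub> (a \<otimes> c)"
    by (simp add: add_group_def)
qed

text \<open>For \<open>g\<close> in the socle, products with \<open>g\<close> on the left are sums,
  and the translation by \<open>t \<one>\<close> is \<open>t\<close> itself.\<close>

lemma socle_apply:
  assumes g: "g \<in> carrier M" "fix_lam {g} = carrier M" and t: "t \<in> K"
  shows "g \<otimes> t \<one> = t g"
proof -
  have "t \<one> \<in> fix_lam {g}" using g t by simp
  then have "lam g (t \<one>) = t \<one>" by (simp add: fix_lam_def)
  then have "g \<otimes> t \<one> = shift g (t \<one>)" using mult_eq[of g "t \<one>"] g t by (simp add: add_group_def)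
  also have "\<dots> = t g" using comm[of "shift g" t \<one>] shift[OF g(1)] t by simp
  finally show ?thesis .
qed

end

section \<open>The permutation group of a solution\<close>

locale finite_solution =
  fixes X :: "'a set" and r :: "'a \<times> 'a \<Rightarrow> 'a \<times> 'a"
  assumes finite_X: "finite X" and ybe: "ybe_solution X r"
    and nondeg: "nondegenerate X r" and invol: "involutive X r"
begin

abbreviation "\<sigma> \<equiv> sigma_map X r"
abbreviation "\<tau> \<equiv> tau_map X r"
abbreviation "G \<equiv> permutation_group X r"

lemma sigma_Bij: "x \<in> X \<Longrightarrow> \<sigma> x \<in> Bij X"
  using nondeg by (auto simp: nondegenerate_def Bij_def sigma_map_def)

lemma sigma_closed [simp, intro]: "x \<in> X \<Longrightarrow> y \<in> X \<Longrightarrow> \<sigma> x y \<in> X"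
  by (rule Bij_apply_closed[OF sigma_Bij])

lemma tau_closed [simp, intro]: "x \<in> X \<Longrightarrow> y \<in> X \<Longrightarrow> \<tau> x y \<in> X"
  using nondeg bij_betwE[of "\<tau> x" X X] by (simp add: nondegenerate_def)

lemma r_eq: "x \<in> X \<Longrightarrow> y \<in> X \<Longrightarrow> r (x, y) = (\<sigma> x y, \<tau> y x)"
  by (simp add: sigma_map_def tau_map_def)

lemma sigma_sigma_tau: "x \<in> X \<Longrightarrow> y \<in> X \<Longrightarrow> \<sigma> (\<sigma> x y) (\<tau> y x) = x"
proof -
  assume xy: "x \<in> X" "y \<in> X"
  then have "r (r (x, y)) = (x, y)" using invol by (auto simp: involutive_def)
  then show ?thesis using r_eq[OF xy] r_eq[of "\<sigma> x y" "\<tau> y x"] xy by simp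
qed

text \<open>First coordinate of the braid identity.\<close>

lemma sigma_comp:
  assumes "x \<in> X" "y \<in> X" "z \<in> X"
  shows "\<sigma> x (\<sigma> y z) = \<sigma> (\<sigma> x y) (\<sigma> (\<tau> y x) z)"
proof -
  have "(act12 r \<circ> act23 r \<circ> act12 r) (x, y, z) = (act23 r \<circ> act12 r \<circ> act23 r) (x, y, z)"
    using ybe assms by (auto simp: ybe_solution_def)
  then show ?thesis using assms by (simp add: act12_def act23_def r_eq)
qed

lemma carrier_G: "carrier G = generate (BijGroup X) (\<sigma> ` X)"
  by (simp add: permutation_group_def carrier_subgroup_generated carrier_BijGroup
      Int_absorb1 sigma_Bij image_subset_iff)

lemma G_subset_Bij: "carrier G \<subseteq> Bij X"
  unfolding carrier_G carrier_BijGroup[symmetric]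
  by (intro group.generate_incl group_BijGroup) (auto simp: carrier_BijGroup sigma_Bij)

sublocale G: group G
  unfolding permutation_group_def by (intro group.group_subgroup_generated group_BijGroup)

lemma sigma_G [simp, intro]: "x \<in> X \<Longrightarrow> \<sigma> x \<in> carrier G"
  by (auto simp: carrier_G intro: generate.incl)

lemma G_closed [simp]: "g \<in> carrier G \<Longrightarrow> x \<in> X \<Longrightarrow> g x \<in> X"
  by (rule Bij_apply_closed[OF subsetD[OF G_subset_Bij]])

lemma G_mult_apply [simp]:
  "g \<in> carrier G \<Longrightarrow> h \<in> carrier G \<Longrightarrow> x \<in> X \<Longrightarrow> (g \<otimes>\<^bsub>G\<^esub> h) x = g (h x)"
  using G_subset_Bij BijGroup_mult_apply[of g X h x] by (auto simp: permutation_group_def)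

lemma G_one_apply [simp]: "x \<in> X \<Longrightarrow> \<one>\<^bsub>G\<^esub> x = x"
  by (simp add: permutation_group_def BijGroup_one_apply)

lemma G_inv_apply [simp]:
  assumes "g \<in> carrier G" "x \<in> X"
  shows "g ((inv\<^bsub>G\<^esub> g) x) = x" "(inv\<^bsub>G\<^esub> g) (g x) = x"
  using assms G_mult_apply[of g "inv\<^bsub>G\<^esub> g" x] G_mult_apply[of "inv\<^bsub>G\<^esub> g" g x]
  by (simp_all del: G_mult_apply)

lemma G_induct [consumes 1, case_names one sigma inv mult]:
  assumes "g \<in> carrier G" and "P \<one>\<^bsub>G\<^esub>"
    and "\<And>x. x \<in> X \<Longrightarrow> P (\<sigma> x)" and inv: "\<And>x. x \<in> X \<Longrightarrow> P (inv\<^bsub>G\<^esub> \<sigma> x)"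
    and mult: "\<And>g h. g \<in> carrier G \<Longrightarrow> h \<in> carrier G \<Longrightarrow> P g \<Longrightarrow> P h \<Longrightarrow> P (g \<otimes>\<^bsub>G\<^esub> h)"
  shows "P g"
  using assms(1) unfolding carrier_G
proof induction
  case one
  show ?case using assms(2) by (simp add: permutation_group_def)
next
  case (incl h)
  then show ?case using assms(3) by blast
next
  case (inv h)
  then obtain x where x: "x \<in> X" "h = \<sigma> x" by blast
  have "inv\<^bsub>BijGroup X\<^esub> h = inv\<^bsub>G\<^esub> h"
    using group.inv_subgroup_generated[OF group_BijGroup, of h X "\<sigma> ` X"] sigma_G[OF x(1)] x
    by (simp add: permutation_group_def)
  then show ?case using x assms(4) by simp
next
  case (eng g h)
  then show ?case using mult[of g h] by (simp add: permutation_group_def carrier_G[unfolded permutation_group_def])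
qed

lemma G_eqI:
  assumes "g \<in> carrier G" "h \<in> carrier G" "\<And>x. x \<in> X \<Longrightarrow> g x = h x"
  shows "g = h"
  using assms G_subset_Bij by (auto simp: Bij_def intro: extensionalityI)

lemma finite_G: "finite (carrier G)"
proof (rule finite_subset)
  show "carrier G \<subseteq> X \<rightarrow>\<^sub>E X"
    using G_subset_Bij by (auto simp: Bij_def PiE_def bij_betw_def)
  show "finite (X \<rightarrow>\<^sub>E X)" using finite_X by (rule finite_PiE) (simp add: finite_X)
qed

text \<open>For u = \<sigma>_x^-1(x), involutivity gives \<open>\<tau> u x = u\<close>. If
  \<open>y\<close> has the same u, then \<open>\<tau> u\<close> sends \<open>x\<close> and
  \<open>y\<close> to the same point, and it is injective.\<close>

lemma inv_sigma_eq_inj: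
  assumes "x \<in> X" "y \<in> X" "(inv\<^bsub>G\<^esub> \<sigma> x) x = (inv\<^bsub>G\<^esub> \<sigma> y) y"
  shows "x = y"
proof -
  have fixed: "\<tau> ((inv\<^bsub>G\<^esub> \<sigma> x) x) x = (inv\<^bsub>G\<^esub> \<sigma> x) x" if x: "x \<in> X" for x
  proof -
    have "\<sigma> x (\<tau> ((inv\<^bsub>G\<^esub> \<sigma> x) x) x) = x"
      using sigma_sigma_tau[of x "(inv\<^bsub>G\<^esub> \<sigma> x) x"] x by simp
    then show ?thesis using G_inv_apply(2)[of "\<sigma> x" "\<tau> ((inv\<^bsub>G\<^esub> \<sigma> x) x) x"] x by simp
  qed
  have "inj_on (\<tau> ((inv\<^bsub>G\<^esub> \<sigma> x) x)) X"
    using nondeg assms(1) by (auto simp: nondegenerate_def bij_betw_def)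
  moreover have "\<tau> ((inv\<^bsub>G\<^esub> \<sigma> x) x) x = \<tau> ((inv\<^bsub>G\<^esub> \<sigma> x) x) y"
    using fixed[OF assms(1)] fixed[OF assms(2)] assms(3) by simp
  ultimately show ?thesis using assms(1,2) by (rule inj_onD)
qed

text \<open>
  The translations \<open>T x\<close> generate the additive group of the permutation brace: they act regularly
  on \<open>G\<close>, and \<open>T x\<close> becomes addition of \<open>\<sigma> x\<close>.
\<close>

definition T :: "'a \<Rightarrow> ('a \<Rightarrow> 'a) \<Rightarrow> ('a \<Rightarrow> 'a)" where
  "T x = (\<lambda>g\<in>carrier G. g \<otimes>\<^bsub>G\<^esub> \<sigma> ((inv\<^bsub>G\<^esub> g) x))"

lemma T_apply: "g \<in> carrier G \<Longrightarrow> T x g = g \<otimes>\<^bsub>G\<^esub> \<sigma> ((inv\<^bsub>G\<^esub> g) x)"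
  by (simp add: T_def)

text \<open>With u = g^-1(x), the inverse of \<open>T x g\<close> sends \<open>x\<close> to
  \<sigma>_u^-1(u). This determines u by \<open>inv_sigma_eq_inj\<close>, and then \<open>g\<close>;
  finiteness gives surjectivity.\<close>

lemma T_Bij:
  assumes x: "x \<in> X"
  shows "T x \<in> Bij (carrier G)"
proof -
  have "inj_on (T x) (carrier G)"
  proof (rule inj_onI)
    fix g h assume gh: "g \<in> carrier G" "h \<in> carrier G" "T x g = T x h"
    let ?u = "(inv\<^bsub>G\<^esub> g) x" and ?v = "(inv\<^bsub>G\<^esub> h) x"
    have uv: "?u \<in> X" "?v \<in> X" using gh x by auto
    have eq: "g \<otimes>\<^bsub>G\<^esub> \<sigma> ?u = h \<otimes>\<^bsub>G\<^esub> \<sigma> ?v" using gh by (simp add: T_apply)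
    have key: "(inv\<^bsub>G\<^esub> (k \<otimes>\<^bsub>G\<^esub> \<sigma> w)) x = (inv\<^bsub>G\<^esub> \<sigma> w) w"
      if "k \<in> carrier G" "w \<in> X" "w = (inv\<^bsub>G\<^esub> k) x" for k w
      using that x by (simp add: G.inv_mult_group)
    have "(inv\<^bsub>G\<^esub> \<sigma> ?u) ?u = (inv\<^bsub>G\<^esub> \<sigma> ?v) ?v"
      using key[of g ?u] key[of h ?v] gh uv eq by simp
    then have "?u = ?v" using inv_sigma_eq_inj uv by blast
    then show "g = h" using eq gh uv by simp
  qed
  moreover have "T x ` carrier G \<subseteq> carrier G" using x by (auto simp: T_apply)
  ultimately have "bij_betw (T x) (carrier G) (carrier G)"
    using finite_G by (simp add: bij_betw_def endo_inj_surj)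
  then show ?thesis by (simp add: Bij_def T_def)
qed

lemma T_comm:
  assumes x: "x \<in> X" and y: "y \<in> X" and g: "g \<in> carrier G"
  shows "T x (T y g) = T y (T x g)"
proof -
  have expand: "T x (T y g) = g \<otimes>\<^bsub>G\<^esub> (\<sigma> ((inv\<^bsub>G\<^esub> g) y) \<otimes>\<^bsub>G\<^esub>
      \<sigma> ((inv\<^bsub>G\<^esub> \<sigma> ((inv\<^bsub>G\<^esub> g) y)) ((inv\<^bsub>G\<^esub> g) x)))" if "x \<in> X" "y \<in> X" for x y
    using that g by (simp add: T_apply G.inv_mult_group G.m_assoc)
  \<comment> \<open>With u = g^-1(x) and v = g^-1(y) this is all that commutation requires; it is
    \<open>sigma_comp\<close> at v and \<sigma>_v^-1(u).\<close>
  have swap: "\<sigma> v \<otimes>\<^bsub>G\<^esub> \<sigma> ((inv\<^bsub>G\<^esub> \<sigma> v) u) = \<sigma> u \<otimes>\<^bsub>G\<^esub> \<sigma> ((inv\<^bsub>G\<^esub> \<sigma> u) v)"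
    if uv: "u \<in> X" "v \<in> X" for u v
  proof (rule G_eqI)
    fix z assume z: "z \<in> X"
    let ?w = "(inv\<^bsub>G\<^esub> \<sigma> v) u"
    have w: "?w \<in> X" "\<sigma> v ?w = u" using uv by auto
    have "\<sigma> u (\<tau> ?w v) = v" using sigma_sigma_tau[of v ?w] uv w by simp
    then have "\<tau> ?w v = (inv\<^bsub>G\<^esub> \<sigma> u) v"
      using G_inv_apply(2)[of "\<sigma> u" "\<tau> ?w v"] uv w by simp
    then show "(\<sigma> v \<otimes>\<^bsub>G\<^esub> \<sigma> ?w) z = (\<sigma> u \<otimes>\<^bsub>G\<^esub> \<sigma> ((inv\<^bsub>G\<^esub> \<sigma> u) v)) z"
      using sigma_comp[of v ?w z] uv w z by simp
  qed (use uv in auto)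
  show ?thesis using expand swap x y g by simp
qed

definition "K = generate (BijGroup (carrier G)) (T ` X)"

lemma subgroup_K: "subgroup K (BijGroup (carrier G))"
  unfolding K_def using T_Bij by (intro group.generate_is_subgroup group_BijGroup) (auto simp: carrier_BijGroup)

lemma K_Bij: "t \<in> K \<Longrightarrow> t \<in> Bij (carrier G)"
  using subgroup.mem_carrier[OF subgroup_K] by (simp add: carrier_BijGroup)

lemma T_in_K: "x \<in> X \<Longrightarrow> T x \<in> K"
  unfolding K_def by (auto intro: generate.incl)

lemma K_comm:
  assumes "s \<in> K" "t \<in> K" "g \<in> carrier G"
  shows "s (t g) = t (s g)"
proof -
  have "s \<otimes>\<^bsub>BijGroup (carrier G)\<^esub> t = t \<otimes>\<^bsub>BijGroup (carrier G)\<^esub> s"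
  proof (rule group.generate_comm[OF group_BijGroup])
    show "T ` X \<subseteq> carrier (BijGroup (carrier G))" using T_Bij by (auto simp: carrier_BijGroup)
    show "s \<in> generate (BijGroup (carrier G)) (T ` X)" "t \<in> generate (BijGroup (carrier G)) (T ` X)"
      using assms by (simp_all add: K_def)
    fix s t assume "s \<in> T ` X" "t \<in> T ` X"
    then obtain x y where xy: "x \<in> X" "s = T x" "y \<in> X" "t = T y" by (elim imageE)
    have "compose (carrier G) (T x) (T y) = compose (carrier G) (T y) (T x)"
      unfolding compose_def by (rule restrict_ext) (rule T_comm[OF xy(1,3)])
    then show "s \<otimes>\<^bsub>BijGroup (carrier G)\<^esub> t = t \<otimes>\<^bsub>BijGroup (carrier G)\<^esub> s"
      using xy T_Bij by (simp add: BijGroup_def)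
  qed
  then show ?thesis
    using BijGroup_mult_apply[of s "carrier G" t g] BijGroup_mult_apply[of t "carrier G" s g] K_Bij assms by simp
qed

lemma K_transitive:
  assumes "g \<in> carrier G"
  shows "\<exists>t\<in>K. t \<one>\<^bsub>G\<^esub> = g"
proof -
  have closed: "t \<one>\<^bsub>G\<^esub> \<in> carrier G" if "t \<in> K" for t
    using Bij_apply_closed[OF K_Bij[OF that]] by simp
  \<comment> \<open>Generalised over the starting point \<open>t\<close>, so that the product case
    can append the second factor to the point reached by the first.\<close>
  have step: "\<exists>s\<in>K. s \<one>\<^bsub>G\<^esub> = t \<one>\<^bsub>G\<^esub> \<otimes>\<^bsub>G\<^esub> h" if "h \<in> carrier G" "t \<in> K" for h t
    using that
  proof (induction arbitrary: t rule: G_induct)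
    case one
    then show ?case using closed by auto
  next
    case (sigma y)
    define g where "g = t \<one>\<^bsub>G\<^esub>"
    have g: "g \<in> carrier G" using closed[OF sigma(2)] by (simp add: g_def)
    \<comment> \<open>The index \<open>g y\<close> cancels the inverse of \<open>g\<close> inside
      \<open>T\<close>, which turns \<open>T\<close> into right multiplication by \<sigma>_y at this
      one point.\<close>
    have "T (g y) g = g \<otimes>\<^bsub>G\<^esub> \<sigma> y" using g sigma by (simp add: T_apply)
    then have "(T (g y) \<otimes>\<^bsub>BijGroup (carrier G)\<^esub> t) \<one>\<^bsub>G\<^esub> = g \<otimes>\<^bsub>G\<^esub> \<sigma> y"
      using g sigma T_Bij K_Bij by (simp add: BijGroup_mult_apply flip: g_def)
    moreover have "T (g y) \<otimes>\<^bsub>BijGroup (carrier G)\<^esub> t \<in> K"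
      using g sigma T_in_K by (intro subgroup.m_closed[OF subgroup_K]) auto
    ultimately show ?case unfolding g_def by blast
  next
    case (inv y)
    define g where "g = t \<one>\<^bsub>G\<^esub>"
    have g: "g \<in> carrier G" using closed[OF inv(2)] by (simp add: g_def)
    \<comment> \<open>The point that \<open>T (k y)\<close> carries to \<open>g\<close>, so the
      inverse of \<open>T (k y)\<close> carries \<open>g\<close> to \<open>k\<close>.\<close>
    define k where "k = g \<otimes>\<^bsub>G\<^esub> inv\<^bsub>G\<^esub> \<sigma> y"
    have k: "k \<in> carrier G" using g inv by (simp add: k_def)
    have "T (k y) k = g" using g inv k by (simp add: T_apply) (simp add: k_def G.m_assoc)
    then have "(inv\<^bsub>BijGroup (carrier G)\<^esub> T (k y)) g = k"
      using BijGroup_inv_apply(2)[OF T_Bij, of "k y" k] k inv by simp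
    then have "(inv\<^bsub>BijGroup (carrier G)\<^esub> T (k y) \<otimes>\<^bsub>BijGroup (carrier G)\<^esub> t) \<one>\<^bsub>G\<^esub> = k"
      using k inv T_Bij K_Bij by (simp add: BijGroup_mult_apply BijGroup_inv_Bij flip: g_def)
    moreover have "inv\<^bsub>BijGroup (carrier G)\<^esub> T (k y) \<otimes>\<^bsub>BijGroup (carrier G)\<^esub> t \<in> K"
      using k inv T_in_K by (intro subgroup.m_closed[OF subgroup_K] subgroup.m_inv_closed[OF subgroup_K]) auto
    ultimately show ?case unfolding k_def g_def by blast
  next
    case (mult h1 h2)
    obtain s where s: "s \<in> K" "s \<one>\<^bsub>G\<^esub> = t \<one>\<^bsub>G\<^esub> \<otimes>\<^bsub>G\<^esub> h1" using mult by blast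
    obtain u where u: "u \<in> K" "u \<one>\<^bsub>G\<^esub> = s \<one>\<^bsub>G\<^esub> \<otimes>\<^bsub>G\<^esub> h2" using mult s by blast
    have "u \<one>\<^bsub>G\<^esub> = t \<one>\<^bsub>G\<^esub> \<otimes>\<^bsub>G\<^esub> (h1 \<otimes>\<^bsub>G\<^esub> h2)"
      using u s mult(1,2) closed[OF mult(5)] by (simp add: G.m_assoc)
    then show ?case using u by blast
  qed
  have "\<one>\<^bsub>BijGroup (carrier G)\<^esub> \<in> K" by (rule subgroup.one_closed[OF subgroup_K])
  from step[OF assms this] show ?thesis
    using assms by (simp add: BijGroup_one_apply)
qed

text \<open>Left multiplication by \<open>g\<close> conjugates \<open>T x\<close> into
  \<open>T (g x)\<close>; inverses and products follow.\<close>

lemma K_normalized: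
  assumes g: "g \<in> carrier G" and t: "t \<in> K"
  shows "\<exists>s\<in>K. \<forall>x\<in>carrier G. g \<otimes>\<^bsub>G\<^esub> t x = s (g \<otimes>\<^bsub>G\<^esub> x)"
  using t unfolding K_def
proof induction
  case one
  then show ?case using g by (intro bexI[of _ "\<one>\<^bsub>BijGroup (carrier G)\<^esub>"])
      (auto simp: BijGroup_one_apply intro: generate.one)
next
  case (incl t)
  then obtain x where x: "x \<in> X" "t = T x" by blast
  have "g \<otimes>\<^bsub>G\<^esub> T x h = T (g x) (g \<otimes>\<^bsub>G\<^esub> h)" if h: "h \<in> carrier G" for h
    using g x h by (simp add: T_apply G.inv_mult_group G.m_assoc)
  then show ?case using x g by (auto intro!: bexI[of _ "T (g x)"] generate.incl)
next
  case (inv t)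
  then obtain x where x: "x \<in> X" "t = T x" by blast
  have "g \<otimes>\<^bsub>G\<^esub> (inv\<^bsub>BijGroup (carrier G)\<^esub> t) h
      = (inv\<^bsub>BijGroup (carrier G)\<^esub> T (g x)) (g \<otimes>\<^bsub>G\<^esub> h)" if h: "h \<in> carrier G" for h
  proof -
    define k where "k = (inv\<^bsub>BijGroup (carrier G)\<^esub> t) h"
    have k: "k \<in> carrier G" "T x k = h"
      using h x BijGroup_inv_apply(1)[OF T_Bij, of x h] BijGroup_inv_Bij[OF T_Bij, of x]
      by (auto simp: k_def Bij_apply_closed)
    have "T (g x) (g \<otimes>\<^bsub>G\<^esub> k) = g \<otimes>\<^bsub>G\<^esub> T x k"
      using g x k(1) by (simp add: T_apply G.inv_mult_group G.m_assoc)
    then show ?thesis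
      using BijGroup_inv_apply(2)[OF T_Bij, of "g x" "g \<otimes>\<^bsub>G\<^esub> k"] g x k
      unfolding k_def[symmetric] by simp
  qed
  then show ?case using x g by (auto intro!: bexI[of _ "inv\<^bsub>BijGroup (carrier G)\<^esub> T (g x)"] generate.inv)
next
  case (eng t1 t2)
  obtain s1 where s1: "s1 \<in> K" "\<And>x. x \<in> carrier G \<Longrightarrow> g \<otimes>\<^bsub>G\<^esub> t1 x = s1 (g \<otimes>\<^bsub>G\<^esub> x)"
    using eng by (auto simp: K_def)
  obtain s2 where s2: "s2 \<in> K" "\<And>x. x \<in> carrier G \<Longrightarrow> g \<otimes>\<^bsub>G\<^esub> t2 x = s2 (g \<otimes>\<^bsub>G\<^esub> x)"
    using eng by (auto simp: K_def)
  have t: "t1 \<in> Bij (carrier G)" "t2 \<in> Bij (carrier G)" using eng K_Bij K_def by auto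
  have "g \<otimes>\<^bsub>G\<^esub> (t1 \<otimes>\<^bsub>BijGroup (carrier G)\<^esub> t2) x
      = (s1 \<otimes>\<^bsub>BijGroup (carrier G)\<^esub> s2) (g \<otimes>\<^bsub>G\<^esub> x)" if x: "x \<in> carrier G" for x
    using x g t s1 s2 K_Bij Bij_apply_closed[OF t(2) x] by (simp add: BijGroup_mult_apply)
  then show ?case using subgroup.m_closed[OF subgroup_K s1(1) s2(1)] by (auto simp: K_def)
qed

sublocale regular: regular_abelian G K
  by (rule regular_abelian.intro[OF G.is_group regular_abelian_axioms.intro])
    (fact subgroup_K K_comm K_transitive K_normalized)+

text \<open>\<open>T x\<close> and \<open>T y\<close> agree at the identity, hence everywhere by
  regularity; at g^-1 they give \<sigma> of \<open>g x\<close> and of \<open>g y\<close>. Thus the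
  retraction relation is invariant under the permutation group.\<close>

lemma sigma_G_cong:
  assumes g: "g \<in> carrier G" and xy: "x \<in> X" "y \<in> X" "\<sigma> x = \<sigma> y"
  shows "\<sigma> (g x) = \<sigma> (g y)"
proof -
  have "T x \<one>\<^bsub>G\<^esub> = T y \<one>\<^bsub>G\<^esub>" using xy by (simp add: T_apply)
  then have "T x (inv\<^bsub>G\<^esub> g) = T y (inv\<^bsub>G\<^esub> g)"
    using regular.eq_if_eq_at_one[of "T x" "T y"] T_in_K xy g by simp
  then show ?thesis using g xy by (simp add: T_apply)
qed

text \<open>For \<open>g\<close> in the socle, evaluating \<open>T x\<close> at \<open>g\<close>
  gives g\<sigma>_x = g\<sigma>_z with z = g^-1(x). Injectivity would make \<open>g\<close> act
  trivially on \<open>X\<close>.\<close>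

lemma not_inj_sigma:
  assumes cf: "cube_free (order G)" and "card X \<noteq> 1" "X \<noteq> {}"
  shows "\<not> inj_on \<sigma> X"
proof
  assume inj: "inj_on \<sigma> X"
  show False
  proof (cases "order G = 1")
    case True
    then have "\<sigma> x = \<sigma> y" if "x \<in> X" "y \<in> X" for x y
      using that sigma_G by (metis card_1_singletonE order_def singletonD)
    then have "card X \<le> 1" using inj finite_X by (auto simp: card_le_Suc0_iff_eq dest: inj_onD)
    then show False using assms finite_X by (cases "card X") auto
  next
    case False
    then obtain g where g: "g \<in> carrier G" "g \<noteq> \<one>\<^bsub>G\<^esub>" "regular.fix_lam {g} = carrier G"
      using regular.ex_nontrivial_socle[OF finite_G cf] by blast
    have "(inv\<^bsub>G\<^esub> g) x = x" if x: "x \<in> X" for x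
    proof -
      have "g \<otimes>\<^bsub>G\<^esub> T x \<one>\<^bsub>G\<^esub> = T x g" using regular.socle_apply g T_in_K x by blast
      then have "\<sigma> x = \<sigma> ((inv\<^bsub>G\<^esub> g) x)" using g x by (simp add: T_apply)
      then show ?thesis using inj_onD[OF inj] x g by (metis G.inv_closed G_closed)
    qed
    then have "inv\<^bsub>G\<^esub> g = \<one>\<^bsub>G\<^esub>" using g by (intro G_eqI) auto
    then show False using g by (simp add: G.inv_eq_1_iff)
  qed
qed

end

section \<open>Retractions\<close>

context finite_solution
begin

section \<open>Homomorphic images of solutions\<close>

lemma surj_bij_betw_image:
  assumes "f ` X = Z" "bij_betw g X X" "\<And>x. x \<in> X \<Longrightarrow> h (f x) = f (g x)"
  shows "bij_betw h Z Z"
proof -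
  have "h ` Z = f ` (g ` X)" using assms(1,3) by (force simp: image_iff)
  then have "h ` Z = Z" using assms(1,2) by (simp add: bij_betw_def)
  then show ?thesis
    using finite_surj_inj[of Z h] finite_X assms(1) by (auto simp: bij_betw_def)
qed

context
  fixes f :: "'a \<Rightarrow> 'b" and Z t
  assumes surj: "f ` X = Z"
    and hom: "\<And>x y. x \<in> X \<Longrightarrow> y \<in> X \<Longrightarrow> t (f x, f y) = map_prod f f (r (x, y))"
begin

lemma image_sigma: "x \<in> X \<Longrightarrow> y \<in> X \<Longrightarrow> sigma_map Z t (f x) (f y) = f (\<sigma> x y)"
  using surj hom[of x y] by (auto simp: sigma_map_def)

lemma image_tau: "x \<in> X \<Longrightarrow> y \<in> X \<Longrightarrow> tau_map Z t (f y) (f x) = f (\<tau> y x)"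
  using surj hom[of x y] by (auto simp: tau_map_def)

lemma finite_solution_image: "finite_solution Z t"
proof
  have hom': "t (f x, f y) = (f (\<sigma> x y), f (\<tau> y x))" if "x \<in> X" "y \<in> X" for x y
    using that by (simp add: hom r_eq)
  show fin: "finite Z" using surj finite_X by blast
  show "nondegenerate Z t"
    unfolding nondegenerate_def
  proof (intro conjI ballI)
    fix z assume "z \<in> Z"
    then obtain x where x: "x \<in> X" "z = f x" using surj by blast
    show "bij_betw (sigma_map Z t z) Z Z"
      using surj_bij_betw_image[OF surj, of "\<sigma> x"] nondeg x image_sigma by (auto simp: nondegenerate_def)
    show "bij_betw (tau_map Z t z) Z Z"
      using surj_bij_betw_image[OF surj, of "\<tau> x"] nondeg x image_tau by (auto simp: nondegenerate_def)
  qed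
  show inv: "involutive Z t"
    unfolding involutive_def
  proof
    fix p assume "p \<in> Z \<times> Z"
    then obtain x y where xy: "x \<in> X" "y \<in> X" "p = (f x, f y)" using surj by blast
    have "r (r (x, y)) = (x, y)" using invol xy by (auto simp: involutive_def)
    then show "t (t p) = p" using xy hom[of "\<sigma> x y" "\<tau> y x"] by (simp add: hom' r_eq)
  qed
  have "t p \<in> Z \<times> Z" if "p \<in> Z \<times> Z" for p
    using that hom' unfolding surj[symmetric] by (auto intro!: imageI)
  then have "bij_betw t (Z \<times> Z) (Z \<times> Z)"
    using inv unfolding involutive_def
    by (intro bij_betw_byWitness[where f' = t] image_subsetI) blast+
  moreover have "(act12 t \<circ> act23 t \<circ> act12 t) p = (act23 t \<circ> act12 t \<circ> act23 t) p"
    if p: "p \<in> Z \<times> Z \<times> Z" for p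
  proof -
    obtain x y z where xyz: "x \<in> X" "y \<in> X" "z \<in> X" "p = (f x, f y, f z)" using p surj by blast
    have "(act12 r \<circ> act23 r \<circ> act12 r) (x, y, z) = (act23 r \<circ> act12 r \<circ> act23 r) (x, y, z)"
      using ybe xyz by (auto simp: ybe_solution_def)
    then show ?thesis using xyz by (simp add: act12_def act23_def r_eq hom')
  qed
  ultimately show "ybe_solution Z t" by (auto simp: ybe_solution_def)
qed

interpretation Z: finite_solution Z t by (rule finite_solution_image)

lemma fZ: "x \<in> X \<Longrightarrow> f x \<in> Z" using surj by blast

text \<open>Graph of the group epimorphism induced by \<open>f\<close>. As a relation it can be
  built by induction over either group before it is known to be a function.\<close>

definition lifts :: "('a \<Rightarrow> 'a) \<Rightarrow> ('b \<Rightarrow> 'b) \<Rightarrow> bool" where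
  "lifts g h \<longleftrightarrow> g \<in> carrier G \<and> h \<in> carrier Z.G \<and> (\<forall>x\<in>X. h (f x) = f (g x))"

lemma lifts_one: "lifts \<one>\<^bsub>G\<^esub> \<one>\<^bsub>Z.G\<^esub>"
  using fZ by (simp add: lifts_def)

lemma lifts_sigma: "x \<in> X \<Longrightarrow> lifts (\<sigma> x) (Z.\<sigma> (f x))"
  using fZ by (simp add: lifts_def image_sigma)

lemma lifts_inv: "lifts g h \<Longrightarrow> lifts (inv\<^bsub>G\<^esub> g) (inv\<^bsub>Z.G\<^esub> h)"
proof -
  assume gh: "lifts g h"
  have "(inv\<^bsub>Z.G\<^esub> h) (f x) = f ((inv\<^bsub>G\<^esub> g) x)" if x: "x \<in> X" for x
  proof -
    let ?y = "(inv\<^bsub>G\<^esub> g) x"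
    have y: "?y \<in> X" "g ?y = x" using gh x by (simp_all add: lifts_def)
    then have "h (f ?y) = f x" using gh by (simp add: lifts_def)
    then show ?thesis using Z.G_inv_apply(2)[of h "f ?y"] gh y fZ by (simp add: lifts_def)
  qed
  then show ?thesis using gh by (simp add: lifts_def)
qed

lemma lifts_mult: "lifts g h \<Longrightarrow> lifts g' h' \<Longrightarrow> lifts (g \<otimes>\<^bsub>G\<^esub> g') (h \<otimes>\<^bsub>Z.G\<^esub> h')"
  using fZ by (simp add: lifts_def)

lemma ex_lifts_right: "g \<in> carrier G \<Longrightarrow> \<exists>h. lifts g h"
  by (induction rule: G_induct) (blast intro: lifts_one lifts_sigma lifts_inv lifts_mult)+

lemma ex_lifts_left: "h \<in> carrier Z.G \<Longrightarrow> \<exists>g. lifts g h"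
proof (induction rule: Z.G_induct)
  case (sigma z)
  then show ?case using surj lifts_sigma by blast
next
  case (inv z)
  then show ?case using surj lifts_sigma lifts_inv by blast
qed (blast intro: lifts_one lifts_mult)+

lemma lifts_unique:
  assumes "lifts g h" "lifts g h'"
  shows "h = h'"
proof (rule Z.G_eqI)
  fix z assume "z \<in> Z"
  then obtain x where "x \<in> X" "z = f x" using surj by blast
  then show "h z = h' z" using assms by (simp add: lifts_def)
qed (use assms in \<open>simp_all add: lifts_def\<close>)

text \<open>The first isomorphism theorem and Lagrange, applied to the epimorphism with graph
  \<open>lifts\<close>.\<close>

lemma order_image_dvd: "order Z.G dvd order G"
proof -
  define \<Phi> where "\<Phi> g = (THE h. lifts g h)" for g
  have Phi: "\<Phi> g = h" if "lifts g h" for g h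
    unfolding \<Phi>_def using that lifts_unique by blast
  have lifts_Phi: "lifts g (\<Phi> g)" if "g \<in> carrier G" for g
    using ex_lifts_right[OF that] Phi by blast
  interpret \<Phi>: group_hom G Z.G \<Phi>
  proof (intro group_hom.intro group_hom_axioms.intro homI G.is_group Z.G.is_group)
    show "\<Phi> g \<in> carrier Z.G" if "g \<in> carrier G" for g
      using lifts_Phi[OF that] by (simp add: lifts_def)
    show "\<Phi> (g \<otimes>\<^bsub>G\<^esub> h) = \<Phi> g \<otimes>\<^bsub>Z.G\<^esub> \<Phi> h" if "g \<in> carrier G" "h \<in> carrier G" for g h
      using that by (intro Phi lifts_mult lifts_Phi)
  qed
  have "\<Phi> ` carrier G = carrier Z.G"
  proof
    show "\<Phi> ` carrier G \<subseteq> carrier Z.G" by auto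
    show "carrier Z.G \<subseteq> \<Phi> ` carrier G"
    proof
      fix h assume "h \<in> carrier Z.G"
      then obtain g where "lifts g h" using ex_lifts_left by blast
      then show "h \<in> \<Phi> ` carrier G" using Phi by (auto simp: lifts_def)
    qed
  qed
  from \<Phi>.FactGroup_iso_set[OF this]
  have "card (carrier (G Mod kernel G Z.G \<Phi>)) = card (carrier Z.G)"
    by (auto simp: iso_def dest: bij_betw_same_card)
  then have "card (rcosets\<^bsub>G\<^esub> kernel G Z.G \<Phi>) = order Z.G"
    by (simp add: FactGroup_def order_def)
  then show ?thesis using G.lagrange[OF \<Phi>.subgroup_kernel] by (metis dvd_triv_left)
qed

end

section \<open>The retraction as a homomorphic image\<close>

abbreviation "cls x \<equiv> retract_rel X r `` {x}"

lemma cls_eq_iff: "x \<in> X \<Longrightarrow> y \<in> X \<Longrightarrow> cls x = cls y \<longleftrightarrow> \<sigma> x = \<sigma> y"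
  using eq_equiv_class_iff[OF equiv_retract_rel, of x X y r] by (simp add: retract_rel_def)

lemma retraction_set_eq: "retraction_set X r = cls ` X"
  by (auto simp: retraction_set_def quotient_def)

lemma retraction_map_cls:
  assumes xy: "x \<in> X" "y \<in> X"
  shows "retraction_map X r (cls x, cls y) = map_prod cls cls (r (x, y))"
proof -
  have eq: "cls (\<sigma> x' y') = cls (\<sigma> x y) \<and> cls (\<tau> y' x') = cls (\<tau> y x)"
    if "x' \<in> cls x" "y' \<in> cls y" for x' y'
  proof -
    have xy': "x' \<in> X" "y' \<in> X" "\<sigma> x' = \<sigma> x" "\<sigma> y' = \<sigma> y"
      using that by (auto simp: retract_rel_def)
    have s: "\<sigma> (\<sigma> x' y') = \<sigma> (\<sigma> x y)"
      using sigma_G_cong[of "\<sigma> x" y' y] xy xy' by simp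
    \<comment> \<open>Involutivity expresses \<tau>_y(x) as a group element applied to
      \<open>x\<close>. That element depends only on the classes, so \<open>sigma_G_cong\<close>
      covers the second coordinate too.\<close>
    have tau: "\<tau> y x = (inv\<^bsub>G\<^esub> \<sigma> (\<sigma> x y)) x" if "x \<in> X" "y \<in> X" for x y
      using sigma_sigma_tau[of x y] G_inv_apply(2)[of "\<sigma> (\<sigma> x y)" "\<tau> y x"] that by simp
    have "\<sigma> (\<tau> y' x') = \<sigma> (\<tau> y x)"
      using sigma_G_cong[of "inv\<^bsub>G\<^esub> \<sigma> (\<sigma> x y)" x' x] xy xy' s tau[of x y] tau[of x' y'] by simp
    then show ?thesis using s xy xy' by (simp add: cls_eq_iff)
  qed
  \<comment> \<open>The unions are over non-empty index sets with constant terms, so they collapse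
    to a single class.\<close>
  have self: "x \<in> cls x" "y \<in> cls y" using xy by (auto simp: retract_rel_def)
  have "(\<Union>x'\<in>cls x. \<Union>y'\<in>cls y. cls (\<sigma> x' y')) = cls (\<sigma> x y)"
    using eq self by blast
  moreover have "(\<Union>x'\<in>cls x. \<Union>y'\<in>cls y. cls (\<tau> y' x')) = cls (\<tau> y x)"
    using eq self by blast
  ultimately show ?thesis using xy by (simp add: retraction_map_def r_eq)
qed

lemma retraction_copy:
  assumes cf: "cube_free (order G)" and X: "card X \<noteq> 1" "X \<noteq> {}"
  obtains Z :: "'a set" and t where "isomorphic_solutions (retraction_set X r) (retraction_map X r) Z t"
    "finite_solution Z t" "Z \<noteq> {}" "order (permutation_group Z t) dvd order G" "card Z < card X"
proof -
  obtain Z :: "'a set" and t where iso: "isomorphic_solutions (retraction_set X r) (retraction_map X r) Z t"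
    using retraction_copy_exists by blast
  then obtain e where e: "bij_betw e (retraction_set X r) Z"
    and hom: "\<And>p. p \<in> retraction_set X r \<times> retraction_set X r \<Longrightarrow>
      t (map_prod e e p) = map_prod e e (retraction_map X r p)"
    by (auto simp: isomorphic_solutions_def)
  \<comment> \<open>Composing the class map with the isomorphism presents the copy as a homomorphic
    image of \<open>X\<close>.\<close>
  define f where "f = e \<circ> cls"
  have surj: "f ` X = Z"
    using e by (auto simp: f_def retraction_set_eq bij_betw_def)
  have hom': "t (f x, f y) = map_prod f f (r (x, y))" if "x \<in> X" "y \<in> X" for x y
    using hom[of "(cls x, cls y)"] that by (simp add: f_def retraction_set_eq retraction_map_cls r_eq)
  have "\<not> inj_on cls X" using not_inj_sigma[OF cf X] by (auto simp: inj_on_def cls_eq_iff)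
  then have "card (cls ` X) < card X"
    using finite_X by (metis card_image_le eq_card_imp_inj_on nat_less_le)
  then have "card Z < card X" using bij_betw_same_card[OF e] by (simp add: retraction_set_eq)
  then show thesis
    using that iso finite_solution_image[OF surj hom'] order_image_dvd[OF surj hom'] surj X by blast
qed

end

section \<open>Descent to a single point\<close>

lemma cube_free_dvd: "cube_free n \<Longrightarrow> d dvd n \<Longrightarrow> cube_free d"
  unfolding cube_free_def by (auto intro: dvd_trans gr0I)

text \<open>Strong induction on the size of the current retraction \<open>Y\<close>, with the
  original solution fixed. Cube-freeness survives each step because the new group order divides the
  old one.\<close>

lemma multipermutation_if_iterated_retraction:
  assumes "iterated_retraction X r m Y s" "finite_solution Y s" "Y \<noteq> {}"
    and "cube_free (order (permutation_group Y s))"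
  shows "multipermutation X r"
  using assms
proof (induction "card Y" arbitrary: m Y s rule: less_induct)
  case less
  interpret finite_solution Y s by fact
  show ?case
  proof (cases "card Y = 1")
    case True
    then show ?thesis using less.prems unfolding multipermutation_def by blast
  next
    case False
    from retraction_copy[OF less.prems(4) False less.prems(3)] show ?thesis
      using less.hyps iterated_retraction.Suc[OF less.prems(1)] cube_free_dvd[OF less.prems(4)] by metis
  qed
qed

theorem theorem11:
  fixes X :: "'a set" and r :: "'a \<times> 'a \<Rightarrow> 'a \<times> 'a"
  assumes "finite X" and "X \<noteq> {}"
    and "ybe_solution X r"
    and "nondegenerate X r"
    and "involutive X r"
    and "cube_free (order (permutation_group X r))"
  shows "multipermutation X r"
  by (rule multipermutation_if_iterated_retraction[OF iterated_retraction.zero finite_solution.intro])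
    (fact assms)+

end
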